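(* Let $\mathbf{k}$ be a field and let $U_n$ denote the restriction of the Tchebyshev transform of the second kind $U$ to the space $\mathbf{k}\langle\mathbf{a},\mathbf{b}\rangle_n$ of homogeneous $\mathbf{ab}$-polynomials of degree $n$ with coefficients in $\mathbf{k}$. Then the linear operator $U_n$ is diagonalizable and has the eigenvalue $2^{i+1}$ of multiplicity $\binom{n}{i}$ for $0\le i\le n$. Furthermore, a complete set of eigenvectors (a basis of $\mathbf{k}\langle\mathbf{a},\mathbf{b}\rangle_n$ consisting of $2^n$ eigenvectors) can be obtained by starting with $1$ and repeatedly applying, $n$ times and in all possible ways, the two operations $$u\longmapsto \mathrm{Pyr}(u)=M(u,1),\qquad u\longmapsto L(u)=(\mathbf{a}-\mathbf{b})\cdot u .$$
   Context: $\mathbf{k}\langle\mathbf{a},\mathbf{b}\rangle$ is the algebra of polynomials over $\mathbf{k}$ in noncommuting variables $\mathbf{a},\mathbf{b}$ of degree $1$ (its elements are called $\mathbf{ab}$-polynomials); $\mathbf{k}\langle\mathbf{a},\mathbf{b}\rangle_n$ is its degree-$n$ homogeneous part, of dimension $2^n$. The maps below are defined with integer coefficients and are extended linearly (or bilinearly) to coefficients in $\mathbf{k}$. Coproduct: for a monomial $u_1\cdots u_n$ (each $u_i$ being $\mathbf{a}$ or $\mathbf{b}$), $\Delta(u_1\cdots u_n)=\sum_{i=1}^n u_1\cdots u_{i-1}\otimes u_{i+1}\cdots u_n$ (so $\Delta(1)=0$), extended linearly; it is coassociative. $\Delta^1=\mathrm{id}$, $\Delta^{k+1}=(\mathrm{id}\otimes\Delta^k)\circ\Delta$,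 with Sweedler notation $\Delta^k(u)=\sum_u u_{(1)}\otimes\cdots\otimes u_{(k)}$. $A$ is the algebra map to scalars with $A(\mathbf{a})=1$, $A(\mathbf{b})=0$; $C(u)=2A(u)+\sum_u A(u_{(1)})A(u_{(2)})$. For homogeneous $u$, $\kappa(u)=A(u)(\mathbf{a}-\mathbf{b})^{\deg u}$ and $\nu(u)=C(u)(\mathbf{a}-\mathbf{b})^{\deg u}$, extended linearly. Let $T(u)=\sum_{k\ge1}\sum_u \nu(u_{(1)})\cdot\mathbf{b}\cdot\nu(u_{(2)})\cdot\mathbf{b}\cdots\mathbf{b}\cdot\nu(u_{(k-1)})\cdot\mathbf{b}\cdot\kappa(u_{(k)})$, where the coproduct is into $k$ parts (the $k=1$ term is $\kappa(u)$). Let $H^*$ be the linear map with $H^*(1)=0$ and $H^*(u\cdot\mathbf{a})=H^*(u\cdot\mathbf{b})=u$. The Tchebyshev transform of the second kind is $U(u)=H^*(T(u\cdot\mathbf{a}))$; it preserves degree. The operator $M$: for a finite graded poset $P$ (with minimal element $\widehat 0$, maximal element $\widehat 1$, rank function $\rho$, $\rho(x,y)=\rho(y)-\rho(x)$) of rank at least $1$, the $\mathbf{ab}$-index is $\Psi(P)=\sum_c (\mathbf{a}-\mathbf{b})^{\rho(x_0,x_1)-1}\cdot\mathbf{b}\cdot(\mathbf{a}-\mathbf{b})^{\rho(x_1,x_2)-1}\cdot\mathbf{b}\cdots\mathbf{b}\cdot(\mathbf{a}-\mathbf{b})^{\rho(x_{k-1},x_k)-1}$, summed over all chains $c=\{\widehat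 0=x_0<x_1<\cdots<x_k=\widehat 1\}$ in $P$. The $\mathbf{ab}$-indices of such posets span all $\mathbf{ab}$-polynomials, and by a known theorem there is a (unique) bilinear operator $M$ on $\mathbf{ab}$-polynomials such that $\Psi(P\times Q)=M(\Psi(P),\Psi(Q))$ for all graded posets $P,Q$ of rank at least $1$, where $P\times Q$ is the Cartesian product.
   Formalization: The characteristic p of k is assumed to be 0 or greater than n+1; otherwise Pyr^(p-1)(1) = L^(p-1)(1), so eigenvectors repeat (p=2, n=1: U_1 is nonzero nilpotent). Where scalars 2^(i+1) coincide in k, their multiplicities are added. *)

theory Defs
  imports
    Complex_Main
    "HOL-Library.Poly_Mapping"
    "HOL-Computational_Algebra.Primes"
begin

section \<open>The algebra of \<open>ab\<close>-polynomials\<close>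

datatype letter = LA | LB

datatype word = Word (letters: "letter list")

text \<open>
  Words form the free monoid on two letters under concatenation. The monoid is written additively,
  because the product on \<^typ>\<open>'w \<Rightarrow>\<^sub>0 'k\<close> is the convolution along the operation of
  \<^class>\<open>monoid_add\<close>; so \<^typ>\<open>word \<Rightarrow>\<^sub>0 'k\<close> is the free associative algebra on two generators.
\<close>

instantiation word :: monoid_add
begin

definition "0 = Word []"

definition "v + w = Word (letters v @ letters w)"

instance
  by standard (simp_all add: zero_word_def plus_word_def)

end

type_synonym 'k ab = "word \<Rightarrow>\<^sub>0 'k"

abbreviation wlen :: "word \<Rightarrow> nat" where
  "wlen w \<equiv> length (letters w)"

definition mon :: "word \<Rightarrow> 'k::field ab" where
  "mon w = Poly_Mapping.single w 1"

definition aa :: "'k::field ab" where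
  "aa = mon (Word [LA])"

definition bb :: "'k::field ab" where
  "bb = mon (Word [LB])"

definition scale :: "'k::field \<Rightarrow> 'k ab \<Rightarrow> 'k ab" where
  "scale c u = Poly_Mapping.map (\<lambda>x. c * x) u"

lemma lookup_scale [simp]: "Poly_Mapping.lookup (scale c u) w = c * Poly_Mapping.lookup u w"
  unfolding scale_def by (simp add: Poly_Mapping.map.rep_eq when_def)

global_interpretation ab: vector_space "scale :: 'k::field \<Rightarrow> 'k ab \<Rightarrow> 'k ab"
  by unfold_locales
    (auto intro!: poly_mapping_eqI simp: lookup_add algebra_simps)

definition homog :: "nat \<Rightarrow> 'k::field ab set" where
  "homog n = {u. \<forall>w \<in> Poly_Mapping.keys u. wlen w = n}"

text \<open>The linear map with prescribed values on the monomial basis.\<close>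

definition lin_ext :: "(word \<Rightarrow> 'k ab) \<Rightarrow> 'k::field ab \<Rightarrow> 'k ab" where
  "lin_ext f u = (\<Sum>w \<in> Poly_Mapping.keys u. scale (Poly_Mapping.lookup u w) (f w))"


section \<open>The Tchebyshev transform of the second kind\<close>

text \<open>
  On a monomial the coproduct and its iterates are sums of tensors of monomials with all
  coefficients 1 (and repetitions). They are represented by the list of the summands, a summand in
  the \<open>k\<close>-fold tensor power being a list of \<open>k\<close> words; Sweedler sums become sums over these lists.
\<close>

definition coprod :: "word \<Rightarrow> (word \<times> word) list" where
  "coprod w = map (\<lambda>i. (Word (take i (letters w)), Word (drop (Suc i) (letters w)))) [0..<wlen w]"

text \<open>\<open>coprod_iter k\<close> is \<open>\<Delta>\<^sup>k\<close> for \<open>k \<ge> 1\<close>; the value for \<open>k = 0\<close> is never used.\<close>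

fun coprod_iter :: "nat \<Rightarrow> word \<Rightarrow> word list list" where
  "coprod_iter 0 w = []"
| "coprod_iter (Suc 0) w = [[w]]"
| "coprod_iter (Suc (Suc k)) w =
     concat (map (\<lambda>(x, y). map (\<lambda>ws. x # ws) (coprod_iter (Suc k) y)) (coprod w))"

definition A_mon :: "word \<Rightarrow> 'k::field" where
  "A_mon w = (\<Prod>l\<leftarrow>letters w. case l of LA \<Rightarrow> 1 | LB \<Rightarrow> 0)"

definition C_mon :: "word \<Rightarrow> 'k::field" where
  "C_mon w = 2 * A_mon w + (\<Sum>(x, y)\<leftarrow>coprod w. A_mon x * A_mon y)"

definition kappa_mon :: "word \<Rightarrow> 'k::field ab" where
  "kappa_mon w = scale (A_mon w) ((aa - bb) ^ wlen w)"

definition nu_mon :: "word \<Rightarrow> 'k::field ab" where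
  "nu_mon w = scale (C_mon w) ((aa - bb) ^ wlen w)"

fun T_term :: "word list \<Rightarrow> 'k::field ab" where
  "T_term [] = 0"
| "T_term [w] = kappa_mon w"
| "T_term (w # v # ws) = nu_mon w * bb * T_term (v # ws)"

text \<open>
  Each application of \<open>\<Delta>\<close> lowers the degree by one, so \<open>\<Delta>\<^sup>k\<close> vanishes on a monomial of degree \<open>d\<close>
  for \<open>k > d + 1\<close>, which is why the sum over all \<open>k \<ge> 1\<close> may stop at \<open>d + 1\<close>.
\<close>

definition T_mon :: "word \<Rightarrow> 'k::field ab" where
  "T_mon w = (\<Sum>k = 1..wlen w + 1. \<Sum>ws\<leftarrow>coprod_iter k w. T_term ws)"

definition T :: "'k::field ab \<Rightarrow> 'k ab" where
  "T = lin_ext T_mon"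

definition H_star :: "'k::field ab \<Rightarrow> 'k ab" where
  "H_star = lin_ext (\<lambda>w. if w = 0 then 0 else mon (Word (butlast (letters w))))"

definition U :: "'k::field ab \<Rightarrow> 'k ab" where
  "U u = H_star (T (u * aa))"


section \<open>Graded posets, the \<open>ab\<close>-index, and the operator \<open>M\<close>\<close>

record 'p poset =
  elems :: "'p set"
  ord :: "'p rel"
  rk :: "'p \<Rightarrow> nat"

definition covers :: "'p poset \<Rightarrow> 'p \<Rightarrow> 'p \<Rightarrow> bool" where
  "covers P y x \<longleftrightarrow> (x, y) \<in> ord P \<and> x \<noteq> y \<and>
     (\<forall>z. (x, z) \<in> ord P \<and> (z, y) \<in> ord P \<longrightarrow> z = x \<or> z = y)"

definition is_bot :: "'p poset \<Rightarrow> 'p \<Rightarrow> bool" where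
  "is_bot P x \<longleftrightarrow> x \<in> elems P \<and> (\<forall>y \<in> elems P. (x, y) \<in> ord P)"

definition is_top :: "'p poset \<Rightarrow> 'p \<Rightarrow> bool" where
  "is_top P x \<longleftrightarrow> x \<in> elems P \<and> (\<forall>y \<in> elems P. (y, x) \<in> ord P)"

definition graded_poset :: "'p poset \<Rightarrow> bool" where
  "graded_poset P \<longleftrightarrow>
     finite (elems P) \<and> partial_order_on (elems P) (ord P) \<and>
     (\<exists>x. is_bot P x \<and> rk P x = 0) \<and> (\<exists>x. is_top P x) \<and>
     (\<forall>x y. covers P y x \<longrightarrow> rk P y = rk P x + 1)"

definition rank_ge_1 :: "'p poset \<Rightarrow> bool" where
  "rank_ge_1 P \<longleftrightarrow> (\<forall>x. is_top P x \<longrightarrow> rk P x \<ge> 1)"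

text \<open>Chains from the minimal to the maximal element, listed in increasing order.\<close>

definition bounded_chains :: "'p poset \<Rightarrow> 'p list set" where
  "bounded_chains P =
     {xs. xs \<noteq> [] \<and> set xs \<subseteq> elems P \<and> is_bot P (hd xs) \<and> is_top P (last xs) \<and>
          sorted_wrt (\<lambda>x y. (x, y) \<in> ord P \<and> x \<noteq> y) xs}"

text \<open>
  The last equation is the only one with a factor \<open>bb\<close>: there is one \<open>bb\<close> for each inner element of
  the chain. Lists with fewer than two elements do not occur in posets of rank at least 1.
\<close>

fun chain_weight :: "'p poset \<Rightarrow> 'p list \<Rightarrow> 'k::field ab" where
  "chain_weight P [] = 0"
| "chain_weight P [x] = 0"
| "chain_weight P [x, y] = (aa - bb) ^ (rk P y - rk P x - 1)"
| "chain_weight P (x # y # z # zs) =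
     (aa - bb) ^ (rk P y - rk P x - 1) * bb * chain_weight P (y # z # zs)"

definition ab_index :: "'p poset \<Rightarrow> 'k::field ab" where
  "ab_index P = (\<Sum>xs \<in> bounded_chains P. chain_weight P xs)"

definition poset_prod :: "'p poset \<Rightarrow> 'q poset \<Rightarrow> ('p \<times> 'q) poset" where
  "poset_prod P Q =
     \<lparr> elems = elems P \<times> elems Q,
       ord = {((x, y), (x', y')) | x y x' y'. (x, x') \<in> ord P \<and> (y, y') \<in> ord Q},
       rk = (\<lambda>(x, y). rk P x + rk Q y) \<rparr>"

definition bilinear_op :: "('k::field ab \<Rightarrow> 'k ab \<Rightarrow> 'k ab) \<Rightarrow> bool" where
  "bilinear_op F \<longleftrightarrow>
     (\<forall>v. Vector_Spaces.linear scale scale (\<lambda>u. F u v)) \<and>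
     (\<forall>u. Vector_Spaces.linear scale scale (F u))"

text \<open>
  Every finite poset is isomorphic to one whose elements are natural numbers, so quantifying over
  posets on \<^typ>\<open>nat\<close> covers all finite graded posets.
\<close>

definition M :: "'k::field ab \<Rightarrow> 'k ab \<Rightarrow> 'k ab" where
  "M = (THE F. bilinear_op F \<and>
     (\<forall>(P :: nat poset) (Q :: nat poset). graded_poset P \<and> rank_ge_1 P \<and> graded_poset Q \<and> rank_ge_1 Q \<longrightarrow>
        ab_index (poset_prod P Q) = F (ab_index P) (ab_index Q)))"

definition Pyr :: "'k::field ab \<Rightarrow> 'k ab" where
  "Pyr u = M u 1"

definition L :: "'k::field ab \<Rightarrow> 'k ab" where
  "L u = (aa - bb) * u"

text \<open>
  All results of applying \<open>n\<close> operations, each \<^const>\<open>Pyr\<close> or \<^const>\<open>L\<close>, to \<open>1\<close>. Over a field of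
  characteristic \<open>p > 0\<close>, applying \<^const>\<open>Pyr\<close> \<open>p - 1\<close> times to \<open>1\<close> gives the \<open>ab\<close>-index of the
  Boolean algebra of rank \<open>p\<close>, which is \<open>(aa - bb) ^ (p - 1)\<close> because \<open>p\<close> divides the number of
  its chains of any given type other than the trivial one; \<^const>\<open>L\<close> gives the same. Hence there
  are fewer than \<open>2 ^ n\<close> vectors if \<open>0 < p \<le> n + 1\<close>.
\<close>

primrec pyr_L_orbit :: "nat \<Rightarrow> 'k::field ab set" where
  "pyr_L_orbit 0 = {1}"
| "pyr_L_orbit (Suc n) = Pyr ` pyr_L_orbit n \<union> L ` pyr_L_orbit n"


section \<open>Eigenvectors\<close>

definition eigenspace :: "('k::field ab \<Rightarrow> 'k ab) \<Rightarrow> 'k ab set \<Rightarrow> 'k \<Rightarrow> 'k ab set" where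
  "eigenspace f V c = {v \<in> V. f v = scale c v}"

definition eigenvector :: "('k::field ab \<Rightarrow> 'k ab) \<Rightarrow> 'k ab \<Rightarrow> bool" where
  "eigenvector f v \<longleftrightarrow> v \<noteq> 0 \<and> (\<exists>c. f v = scale c v)"

definition eigenbasis :: "('k::field ab \<Rightarrow> 'k ab) \<Rightarrow> 'k ab set \<Rightarrow> 'k ab set \<Rightarrow> bool" where
  "eigenbasis f V B \<longleftrightarrow> B \<subseteq> V \<and> ab.independent B \<and> ab.span B = V \<and> (\<forall>v \<in> B. eigenvector f v)"

definition diagonalizable_on :: "('k::field ab \<Rightarrow> 'k ab) \<Rightarrow> 'k ab set \<Rightarrow> bool" where
  "diagonalizable_on f V \<longleftrightarrow> f ` V \<subseteq> V \<and> (\<exists>B. eigenbasis f V B)"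

text \<open>
  The multiplicity of an eigenvalue of a diagonalizable operator is the dimension of its eigenspace.
  In positive characteristic some of the scalars \<open>2 ^ (i + 1)\<close> may coincide; the multiplicities
  attached to equal scalars then add up. When they are pairwise distinct, as in characteristic 0,
  the sum has a single term for \<open>c = 2 ^ (i + 1)\<close>.
\<close>

definition tcheb_mult :: "nat \<Rightarrow> 'k::field \<Rightarrow> nat" where
  "tcheb_mult n c = (\<Sum>i | i \<le> n \<and> 2 ^ (i + 1) = c. n choose i)"

end

theory Submission
  imports Defs
begin

text \<open>
  Put \<open>x = a - b\<close>. The words in \<open>x\<close> and \<open>b\<close> are another basis of the \<open>ab\<close>-polynomials, and in it every
  operator involved is given by a short recursion on the first letter.

  \<^item> \<open>\<Delta>\<close> kills \<open>x\<close>, so \<open>x\<close> can be pulled out of \<open>T\<close> on the left. Pulling out \<open>b\<close> leaves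
    \<open>T(bu) = 2 b T(u) + x S(u)\<close> with a companion \<open>S\<close> of \<open>T\<close>. This gives \<open>U(1) = 2\<close>, \<open>U(xu) = x U(u)\<close>,
    \<open>U(bu) = 2 b U(u) + x V(u)\<close>, where \<open>V(1) = 1\<close>, \<open>V(xu) = x V(u)\<close> and \<open>V(bu) = b U(u)\<close>.
  \<^item> The first step of a chain in \<open>P \<times> Q\<close> moves the first coordinate, the second one or both.
    Accordingly \<open>M\<close> is a sum of three bilinear operators with recursions of their own, from which
    \<open>Pyr(1) = x + 2b\<close>, \<open>Pyr(xu) = x Pyr(u) + bxu - xbu\<close> and \<open>Pyr(bu) = b Pyr(u) + xbu + bbu\<close>. That the
    characterising property determines \<open>M\<close> is seen on posets with one or two elements in each inner
    rank: their \<open>ab\<close>-indices are all the products of factors \<open>a\<close> and \<open>a + b\<close>.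

  An induction on words in \<open>x\<close> and \<open>b\<close> then yields \<open>U \<circ> Pyr = 2 Pyr \<circ> U\<close> (\<open>U_Pyr\<close>), while
  \<open>U \<circ> L = L \<circ> U\<close>. Hence \<open>i\<close> applications of \<open>Pyr\<close> and \<open>n - i\<close> applications of \<open>L\<close> to \<open>1\<close>, in any order,
  produce a vector with \<open>U v = 2 ^ (i + 1) v\<close>, and there are \<open>n choose i\<close> such orders.

  It remains to see that these at most \<open>2 ^ n\<close> vectors span the \<open>2 ^ n\<close>-dimensional space of degree
  \<open>n\<close>. Let \<open>W n\<close> be the space of degree \<open>n\<close>. The image of \<open>L\<close> in \<open>W (n + 1)\<close> is \<open>x (W n)\<close>, so \<open>Pyr\<close> has
  to induce a surjection of \<open>W n\<close> onto \<open>W (n + 1) / x (W n)\<close>, which is isomorphic to \<open>W n\<close> by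
  \<open>v \<mapsto> b v\<close>. The resulting endomorphism of \<open>W n\<close> is triangular with diagonal entries among
  \<open>1, ..., n + 2\<close> (\<open>Pyr_modulo_xx_surj\<close>), and as long as \<open>n + 1\<close> is at most the degree in
  question, these are nonzero by the hypothesis on the characteristic of the field. Independence
  and all dimensions follow by counting.
\<close>


section \<open>Linear algebra of \<open>ab\<close>-polynomials\<close>

definition xx :: "'k::field ab" where
  "xx = aa - bb"

abbreviation lin :: "('k::field ab \<Rightarrow> 'k ab) \<Rightarrow> bool" where
  "lin f \<equiv> Vector_Spaces.linear scale scale f"

lemma lin_iff:
  "lin f \<longleftrightarrow> (\<forall>u v. f (u + v) = f u + f v) \<and> (\<forall>c u. f (scale c u) = scale c (f u))"
  by (auto simp: Vector_Spaces.linear_iff intro: ab.vector_space_axioms)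

lemma lin_add: "lin f \<Longrightarrow> f (u + v) = f u + f v"
  by (simp add: lin_iff)

lemma lin_scale: "lin f \<Longrightarrow> f (scale c u) = scale c (f u)"
  by (simp add: lin_iff)

lemma lin_zero: "lin f \<Longrightarrow> f 0 = 0"
  using lin_scale[of f 0 0] by simp

lemma lin_uminus: "lin f \<Longrightarrow> f (- u) = - f u"
  using lin_scale[of f "-1" u] by simp

lemma lin_diff: "lin f \<Longrightarrow> f (u - v) = f u - f v"
  using lin_add[of f u "- v"] lin_uminus[of f v] by simp

lemma lin_sum: "lin f \<Longrightarrow> f (\<Sum>i\<in>I. g i) = (\<Sum>i\<in>I. f (g i))"
  by (induction I rule: infinite_finite_induct) (simp_all add: lin_zero lin_add)

lemma scale_single: "scale c (Poly_Mapping.single w d) = Poly_Mapping.single w (c * d)"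
  by (rule poly_mapping_eqI) (simp add: lookup_single when_def)

lemma scale_mon: "scale c (mon w) = Poly_Mapping.single w c"
  by (simp add: mon_def scale_single)

lemma ab_expand: "u = (\<Sum>w \<in> Poly_Mapping.keys u. scale (Poly_Mapping.lookup u w) (mon w))"
proof (rule poly_mapping_eqI)
  fix v
  have "(\<Sum>w \<in> Poly_Mapping.keys u. Poly_Mapping.lookup (scale (Poly_Mapping.lookup u w) (mon w)) v)
      = (\<Sum>w \<in> Poly_Mapping.keys u. if w = v then Poly_Mapping.lookup u w else 0)"
    by (intro sum.cong) (auto simp: mon_def lookup_single when_def)
  also have "\<dots> = Poly_Mapping.lookup u v"
    by (simp add: in_keys_iff)
  finally show "Poly_Mapping.lookup u v
      = Poly_Mapping.lookup (\<Sum>w \<in> Poly_Mapping.keys u. scale (Poly_Mapping.lookup u w) (mon w)) v"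
    by (simp add: lookup_sum)
qed

lemma mon_mult: "mon v * mon w = mon (v + w)"
  by (simp add: mon_def mult_single)

lemma mon_zero: "mon 0 = 1"
  by (simp add: mon_def)

lemma scale_mult_left: "scale c u * v = scale c (u * v)"
  by (simp add: scale_def mult_map_scale_conv_mult mult.assoc)

lemma scale_mult_right: "u * scale c v = scale c (u * v)"
proof -
  have "scale d (mon w) * Poly_Mapping.single 0 c = Poly_Mapping.single 0 c * scale d (mon w)" for d w
    by (simp add: scale_mon mult_single mult.commute)
  hence "u * Poly_Mapping.single 0 c = Poly_Mapping.single 0 c * u"
    by (subst (1 2) ab_expand[of u]) (simp add: sum_distrib_left sum_distrib_right)
  thus ?thesis
    by (simp add: scale_def mult_map_scale_conv_mult mult.assoc[symmetric])
qed

lemma scale_two: "scale 2 u = 2 * u"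
  using ab.scale_left_distrib[of 1 1 u] by (simp add: mult_2)

lemma lin_mult_left: "lin f \<Longrightarrow> lin (\<lambda>u. v * f u)"
  by (simp add: lin_iff distrib_left scale_mult_right)

lemma lin_mult_right: "lin f \<Longrightarrow> lin (\<lambda>u. f u * v)"
  by (simp add: lin_iff distrib_right scale_mult_left)

lemma lin_comp: "lin f \<Longrightarrow> lin g \<Longrightarrow> lin (\<lambda>u. f (g u))"
  by (simp add: lin_iff)

lemma lin_ident: "lin (\<lambda>u. u)"
  by (simp add: lin_iff)

lemma lin_ext_superset:
  assumes "finite W" "Poly_Mapping.keys u \<subseteq> W"
  shows "lin_ext f u = (\<Sum>w\<in>W. scale (Poly_Mapping.lookup u w) (f w))"
  unfolding lin_ext_def
  by (rule sum.mono_neutral_left) (use assms in \<open>auto simp: in_keys_iff\<close>)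

lemma lin_lin_ext: "lin (lin_ext f)"
  unfolding lin_iff
proof safe
  fix u v :: "'a ab"
  let ?W = "Poly_Mapping.keys u \<union> Poly_Mapping.keys v"
  have "lin_ext f (u + v) = (\<Sum>w\<in>?W. scale (Poly_Mapping.lookup (u + v) w) (f w))"
    by (rule lin_ext_superset) (auto simp: keys_add)
  also have "\<dots> = lin_ext f u + lin_ext f v"
    by (simp add: lin_ext_superset[of ?W] lookup_add ab.scale_left_distrib sum.distrib)
  finally show "lin_ext f (u + v) = lin_ext f u + lin_ext f v" .
next
  fix c and u :: "'a ab"
  have "lin_ext f (scale c u)
      = (\<Sum>w\<in>Poly_Mapping.keys u. scale (Poly_Mapping.lookup (scale c u) w) (f w))"
    by (rule lin_ext_superset) (auto simp: in_keys_iff)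
  thus "lin_ext f (scale c u) = scale c (lin_ext f u)"
    by (simp add: lin_ext_def ab.scale_sum_right)
qed

lemma lin_ext_mon: "lin_ext f (mon w) = f w"
  by (simp add: lin_ext_def mon_def)

lemma lin_eqI:
  assumes "lin f" "lin g" "\<And>ls. f (mon (Word ls)) = g (mon (Word ls))"
  shows "f u = g u"
proof -
  have "f (mon w) = g (mon w)" for w
    using assms(3)[of "letters w"] by simp
  thus ?thesis
    by (subst (1 2) ab_expand[of u]) (simp add: assms lin_sum lin_scale)
qed

lemma mon_Nil: "mon (Word []) = 1"
  by (simp add: mon_zero[symmetric] zero_word_def)

lemma mon_LB: "mon (Word (LB # ls)) = bb * mon (Word ls)"
  by (simp add: bb_def mon_mult plus_word_def)

lemma mon_LA: "mon (Word (LA # ls)) = xx * mon (Word ls) + bb * mon (Word ls)"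
  by (simp add: aa_def bb_def xx_def mon_mult plus_word_def algebra_simps)

text \<open>
  Since \<open>a = x + b\<close>, the polynomial \<open>x = a - b\<close> and \<open>b\<close> generate the same free algebra as
  \<open>a\<close> and \<open>b\<close>. All operators below are easier to describe in terms of \<open>x\<close> and \<open>b\<close>, so this is the
  form of induction in which they are compared.
\<close>

lemma xb_induct [case_names one add scale xx bb]:
  fixes u :: "'k::field ab"
  assumes "P 1"
    and add: "\<And>u v. P u \<Longrightarrow> P v \<Longrightarrow> P (u + v)"
    and scale: "\<And>c u. P u \<Longrightarrow> P (scale c u)"
    and "\<And>u. P u \<Longrightarrow> P (xx * u)"
    and "\<And>u. P u \<Longrightarrow> P (bb * u)"
  shows "P u"
proof -
  have mon: "P (mon (Word ls))" for ls
  proof (induction ls)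
    case (Cons l ls)
    thus ?case
      using assms by (cases l) (simp_all add: mon_LA mon_LB)
  qed (use assms in \<open>simp add: mon_Nil\<close>)
  have P0: "P 0"
    using scale[OF assms(1), of 0] by simp
  have "finite W \<Longrightarrow> P (\<Sum>w\<in>W. scale (c w) (mon w))" for W and c :: "word \<Rightarrow> 'k"
  proof (induction W rule: finite_induct)
    case (insert w W)
    show ?case
      using insert mon[of "letters w"] by (auto intro!: add scale)
  qed (simp add: P0)
  from this[of "Poly_Mapping.keys u"] show ?thesis
    by (subst ab_expand) simp
qed


section \<open>Homogeneous polynomials\<close>

abbreviation words :: "nat \<Rightarrow> letter list set" where
  "words n \<equiv> {ls. length ls = n}"

lemma words_Suc: "words (Suc n) = (#) LA ` words n \<union> (#) LB ` words n"
proof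
  show "words (Suc n) \<subseteq> (#) LA ` words n \<union> (#) LB ` words n"
  proof
    fix ls assume "ls \<in> words (Suc n)"
    then obtain l ms where "ls = l # ms" "length ms = n"
      by (auto simp: length_Suc_conv)
    thus "ls \<in> (#) LA ` words n \<union> (#) LB ` words n"
      by (cases l) auto
  qed
qed auto

lemma finite_words: "finite (words n)"
  by (induction n) (simp_all add: words_Suc)

lemma card_words: "card (words n) = 2 ^ n"
proof (induction n)
  case (Suc n)
  have "card (words (Suc n)) = card ((#) LA ` words n) + card ((#) LB ` words n)"
    unfolding words_Suc by (rule card_Un_disjoint) (auto simp: finite_words)
  thus ?case
    using Suc by (simp add: card_image)
qed simp

lemma homog_iff: "u \<in> homog n \<longleftrightarrow> (\<forall>w. Poly_Mapping.lookup u w \<noteq> 0 \<longrightarrow> wlen w = n)"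
  by (auto simp: homog_def in_keys_iff)

lemma subspace_homog: "ab.subspace (homog n)"
  unfolding ab.subspace_def
proof (intro conjI ballI allI)
  fix u v :: "'a ab"
  assume "u \<in> homog n" "v \<in> homog n"
  thus "u + v \<in> homog n"
    unfolding homog_iff by (metis lookup_add add.right_neutral)
qed (simp_all add: homog_iff)

lemma mon_homog: "mon w \<in> homog (wlen w)"
  by (simp add: homog_iff mon_def lookup_single when_def)

lemma homog_eq_span: "(homog n :: 'k::field ab set) = ab.span ((\<lambda>ls. mon (Word ls)) ` words n)"
    (is "?H = ?S")
proof
  show "?H \<subseteq> ?S"
  proof
    fix u :: "'k ab" assume u: "u \<in> homog n"
    have m: "(mon w :: 'k ab) \<in> ?S" if "w \<in> Poly_Mapping.keys u" for w
      by (rule ab.span_base, rule image_eqI[of _ _ "letters w"]) (use u that in \<open>auto simp: homog_def\<close>)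
    show "u \<in> ?S"
      by (subst ab_expand[of u]) (intro ab.span_sum ab.span_scale m)
  qed
  show "?S \<subseteq> ?H"
  proof (rule ab.span_minimal[OF _ subspace_homog], safe)
    fix ls :: "letter list"
    show "mon (Word ls) \<in> homog (length ls)"
      using mon_homog[of "Word ls"] by simp
  qed
qed

lemma dim_homog: "ab.dim (homog n :: 'k::field ab set) = 2 ^ n"
proof -
  let ?m = "\<lambda>ls. mon (Word ls) :: 'k ab"
  have inj: "inj ?m"
    by (rule injI, drule arg_cong[of _ _ Poly_Mapping.keys]) (simp add: mon_def)
  have "ab.independent (?m ` words n)"
  proof (rule ab.independent_if_scalars_zero)
    fix c :: "'k ab \<Rightarrow> 'k" and v
    assume 0: "(\<Sum>v\<in>?m ` words n. scale (c v) v) = 0" and v: "v \<in> ?m ` words n"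
    then obtain ls where ls: "v = ?m ls" "ls \<in> words n"
      by auto
    have "0 = Poly_Mapping.lookup (\<Sum>v\<in>?m ` words n. scale (c v) v) (Word ls)"
      by (simp add: 0)
    also have "\<dots> = (\<Sum>ms\<in>words n. if ms = ls then c v else 0)"
      unfolding lookup_sum
      by (subst sum.reindex[OF inj_on_subset[OF inj]])
        (auto intro!: sum.cong simp: mon_def lookup_single when_def ls)
    also have "\<dots> = c v"
      using ls finite_words[of n] by (subst sum.delta) auto
    finally show "c v = 0"
      by simp
  qed (simp add: finite_words)
  hence "ab.dim (homog n :: 'k ab set) = card (?m ` words n)"
    unfolding homog_eq_span by (simp add: ab.dim_eq_card_independent)
  thus ?thesis
    by (simp add: card_words card_image inj_on_subset[OF inj])
qed

lemma homog_0: "u \<in> homog 0 \<Longrightarrow> \<exists>c. u = scale c 1"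
  by (auto simp: homog_eq_span mon_Nil ab.span_singleton)

lemma mult_homog: "u \<in> homog m \<Longrightarrow> v \<in> homog n \<Longrightarrow> u * v \<in> homog (m + n)"
  unfolding homog_def using keys_mult[of u v] by (fastforce simp: plus_word_def)

lemma one_homog: "1 \<in> homog 0"
  using mon_homog[of "Word []"] by (simp add: mon_Nil)

lemma bb_homog: "bb \<in> homog 1"
  using mon_homog[of "Word [LB]"] by (simp add: bb_def)

lemma xx_homog: "xx \<in> homog 1"
  using mon_homog[of "Word [LA]"] bb_homog by (auto simp: xx_def aa_def intro!: ab.subspace_diff[OF subspace_homog])

lemma xx_mult_homog: "u \<in> homog n \<Longrightarrow> xx * u \<in> homog (Suc n)"
  using mult_homog[OF xx_homog] by fastforce

lemma bb_mult_homog: "u \<in> homog n \<Longrightarrow> bb * u \<in> homog (Suc n)"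
  using mult_homog[OF bb_homog] by fastforce

text \<open>
  The counterpart of \<open>xb_induct\<close> for inductions on the degree.
\<close>

lemma homog_SucE:
  assumes "u \<in> homog (Suc n)"
  obtains v w where "v \<in> homog n" "w \<in> homog n" "u = xx * v + bb * w"
proof -
  have "u \<in> ab.span ((\<lambda>ls. mon (Word ls)) ` words (Suc n))"
    using assms by (simp add: homog_eq_span)
  hence "\<exists>v\<in>homog n. \<exists>w\<in>homog n. u = xx * v + bb * w"
  proof (induction rule: ab.span_induct_alt)
    case base
    show ?case
      by (intro bexI[of _ 0]) (auto intro: ab.subspace_0[OF subspace_homog])
  next
    case (step c y z)
    then obtain v w where vw: "v \<in> homog n" "w \<in> homog n" "z = xx * v + bb * w"
      by blast
    from step(1) obtain l ls where ls: "y = mon (Word (l # ls))" "length ls = n"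
      by (auto simp: length_Suc_conv)
    let ?m = "mon (Word ls)" and ?e = "case l of LA \<Rightarrow> 1 | LB \<Rightarrow> 0"
    have m: "?m \<in> homog n"
      using mon_homog[of "Word ls"] ls by simp
    have "scale c y + z = xx * (scale (c * ?e) ?m + v) + bb * (scale c ?m + w)"
      by (cases l) (simp_all add: ls vw mon_LA mon_LB algebra_simps scale_mult_right ab.scale_right_distrib)
    moreover have "scale (c * ?e) ?m + v \<in> homog n" "scale c ?m + w \<in> homog n"
      using m vw by (auto intro!: ab.subspace_add[OF subspace_homog] ab.subspace_scale[OF subspace_homog])
    ultimately show ?case
      by blast
  qed
  thus ?thesis
    using that by blast
qed


section \<open>The transform \<open>T\<close> in terms of \<open>x\<close> and \<open>b\<close>\<close>

lemma coprod_Nil: "coprod (Word []) = []"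
  by (simp add: coprod_def)

lemma coprod_Cons:
  "coprod (Word (l # ls))
    = (Word [], Word ls) # map (\<lambda>p. (Word (l # letters (fst p)), snd p)) (coprod (Word ls))"
  by (simp add: coprod_def map_upt_Suc comp_def del: upt_Suc)

lemma wlen_coprod: "p \<in> set (coprod w) \<Longrightarrow> wlen (snd p) < wlen w"
  by (auto simp: coprod_def)

lemma coprod_iter_Suc:
  "coprod_iter (Suc (Suc k)) w
    = concat (map (\<lambda>p. map ((#) (fst p)) (coprod_iter (Suc k) (snd p))) (coprod w))"
  by (simp add: split_def)

lemma coprod_iter_eq_Nil: "wlen w + 1 < k \<Longrightarrow> coprod_iter k w = []"
proof (induction k w rule: coprod_iter.induct)
  case (3 k w)
  have "coprod_iter (Suc k) (snd p) = []" if "p \<in> set (coprod w)" for p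
    using 3(1)[of p "fst p" "snd p"] 3(2) wlen_coprod[OF that] that by simp
  thus ?case
    unfolding coprod_iter_Suc by simp
qed simp_all

lemma coprod_iter_nonempty: "ws \<in> set (coprod_iter k w) \<Longrightarrow> ws \<noteq> []"
  by (induction k w rule: coprod_iter.induct) auto

lemma sum_sum_list: "(\<Sum>k\<in>K. \<Sum>p\<leftarrow>ps. f k p) = (\<Sum>p\<leftarrow>ps. \<Sum>k\<in>K. f k p)"
  by (induction ps) (simp_all add: sum.distrib)

lemma sum_list_concat_map:
  "(\<Sum>q\<leftarrow>concat (map g ps). f q) = (\<Sum>p\<leftarrow>ps. \<Sum>q\<leftarrow>g p. f q)"
  by (induction ps) simp_all

lemma sum_1_Suc: "(\<Sum>k = 1..n + 1. f k) = f 1 + (\<Sum>k = 1..n. f (Suc k))"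
  for f :: "nat \<Rightarrow> 'a::comm_monoid_add"
  by (induction n) (simp_all add: add_ac)

lemma sum_T_term_Cons:
  "(\<And>ws. ws \<in> set wss \<Longrightarrow> ws \<noteq> []) \<Longrightarrow>
    (\<Sum>ws\<leftarrow>wss. T_term (w # ws)) = nu_mon w * bb * (\<Sum>ws\<leftarrow>wss. T_term ws)"
proof (induction wss)
  case (Cons ws wss)
  then obtain v vs where "ws = v # vs"
    by (cases ws) auto
  thus ?case
    using Cons by (simp add: distrib_left)
qed simp

text \<open>
  Because \<open>\<Delta>\<^sup>k\<^sup>+\<^sup>1 = (id \<otimes> \<Delta>\<^sup>k) \<circ> \<Delta>\<close>, the summands with at least two factors can be sorted by their
  first factor; what follows it runs through all summands of \<open>T\<close> at the second component of \<open>\<Delta>\<close>.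
\<close>

lemma T_mon_rec:
  "T_mon w = kappa_mon w + (\<Sum>p\<leftarrow>coprod w. nu_mon (fst p) * bb * T_mon (snd p))"
proof -
  define t where "t k v = (\<Sum>ws\<leftarrow>coprod_iter k v. T_term ws :: 'a ab)" for k v
  have t_Suc: "t (Suc k) w = (\<Sum>p\<leftarrow>coprod w. nu_mon (fst p) * bb * t k (snd p))" if "1 \<le> k" for k
  proof -
    from that obtain j where k: "k = Suc j"
      by (cases k) auto
    have first: "(\<Sum>ws\<leftarrow>coprod_iter k v. T_term (u # ws)) = nu_mon u * bb * t k v" for u v
      unfolding t_def by (rule sum_T_term_Cons) (rule coprod_iter_nonempty)
    have "t (Suc k) w = (\<Sum>p\<leftarrow>coprod w. \<Sum>ws\<leftarrow>coprod_iter k (snd p). T_term (fst p # ws))"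
      unfolding t_def k coprod_iter_Suc sum_list_concat_map map_map comp_def ..
    thus ?thesis
      by (simp only: first)
  qed
  have "T_mon w = t 1 w + (\<Sum>k = 1..wlen w. t (Suc k) w)"
    unfolding T_mon_def t_def[symmetric] by (rule sum_1_Suc)
  also have "(\<Sum>k = 1..wlen w. t (Suc k) w)
      = (\<Sum>k = 1..wlen w. \<Sum>p\<leftarrow>coprod w. nu_mon (fst p) * bb * t k (snd p))"
    by (intro sum.cong) (auto simp: t_Suc)
  also have "\<dots> = (\<Sum>p\<leftarrow>coprod w. nu_mon (fst p) * bb * (\<Sum>k = 1..wlen w. t k (snd p)))"
    unfolding sum_sum_list sum_distrib_left ..
  also have "(\<Sum>k = 1..wlen w. t k (snd p)) = T_mon (snd p)" if "p \<in> set (coprod w)" for p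
    unfolding T_mon_def t_def[symmetric]
    by (rule sum.mono_neutral_right) (use wlen_coprod[OF that] in \<open>auto simp: t_def coprod_iter_eq_Nil\<close>)
  hence "(\<Sum>p\<leftarrow>coprod w. nu_mon (fst p) * bb * (\<Sum>k = 1..wlen w. t k (snd p)))
      = (\<Sum>p\<leftarrow>coprod w. nu_mon (fst p) * bb * T_mon (snd p))"
    by (simp cong: map_cong)
  also have "t 1 w = kappa_mon w"
    by (simp add: t_def)
  finally show ?thesis .
qed

text \<open>
  Since \<open>C(bu) = A(u)\<close>, the first factor of a summand of \<open>T(bu)\<close> is \<open>\<nu>(b u\<^sub>1) = x \<kappa>(u\<^sub>1)\<close> unless it is
  \<open>\<nu>(1)\<close>. So \<open>\<kappa>\<close> takes the place of \<open>\<nu>\<close> in the first factor, and \<open>S\<close> collects these summands.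
\<close>

definition S_mon :: "word \<Rightarrow> 'k::field ab" where
  "S_mon w = (\<Sum>p\<leftarrow>coprod w. kappa_mon (fst p) * bb * T_mon (snd p))"

definition S :: "'k::field ab \<Rightarrow> 'k ab" where
  "S = lin_ext S_mon"

lemma A_mon_simps:
  "A_mon (Word []) = 1" "A_mon (Word (LA # ls)) = A_mon (Word ls)" "A_mon (Word (LB # ls)) = 0"
  by (simp_all add: A_mon_def)

lemma kappa_mon_simps:
  "kappa_mon (Word []) = 1"
  "kappa_mon (Word (LA # ls)) = xx * kappa_mon (Word ls)"
  "kappa_mon (Word (LB # ls)) = 0"
  by (simp_all add: kappa_mon_def A_mon_simps scale_mult_right flip: xx_def)

lemma C_mon_simps:
  "C_mon (Word []) = 2"
  "C_mon (Word (LA # ls)) = C_mon (Word ls) + A_mon (Word ls)"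
  "C_mon (Word (LB # ls)) = A_mon (Word ls)"
  by (simp_all add: C_mon_def A_mon_simps coprod_Nil coprod_Cons split_def comp_def)

lemma nu_mon_simps:
  "nu_mon (Word []) = 2"
  "nu_mon (Word (LA # ls)) = xx * nu_mon (Word ls) + xx * kappa_mon (Word ls)"
  "nu_mon (Word (LB # ls)) = xx * kappa_mon (Word ls)"
  by (simp_all add: nu_mon_def kappa_mon_def C_mon_simps scale_mult_right scale_two
      ab.scale_left_distrib distrib_left flip: xx_def)

lemma S_mon_simps:
  "S_mon (Word []) = 0"
  "S_mon (Word (LA # ls)) = xx * S_mon (Word ls) + bb * T_mon (Word ls)"
  "S_mon (Word (LB # ls)) = bb * T_mon (Word ls)"
  by (simp_all add: S_mon_def coprod_Nil coprod_Cons comp_def kappa_mon_simps mult.assoc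
      sum_list_const_mult)

text \<open>
  In the case of a leading \<open>a\<close>, the identity \<open>\<nu>(au) = x \<nu>(u) + x \<kappa>(u)\<close> splits the sum in \<open>T_mon_rec\<close>
  into a multiple of \<open>T\<close> (up to its \<open>\<kappa>\<close> term) and one of \<open>S\<close>.
\<close>

lemma T_mon_simps:
  "T_mon (Word []) = 1"
  "T_mon (Word (LA # ls)) = xx * T_mon (Word ls) + xx * S_mon (Word ls) + 2 * (bb * T_mon (Word ls))"
  "T_mon (Word (LB # ls)) = xx * S_mon (Word ls) + 2 * (bb * T_mon (Word ls))"
proof -
  show "T_mon (Word []) = 1"
    by (subst T_mon_rec) (simp add: coprod_Nil kappa_mon_simps)
  show "T_mon (Word (LB # ls)) = xx * S_mon (Word ls) + 2 * (bb * T_mon (Word ls))"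
    by (subst T_mon_rec) (simp add: S_mon_def coprod_Cons comp_def kappa_mon_simps nu_mon_simps
      mult.assoc sum_list_const_mult)
  show "T_mon (Word (LA # ls)) = xx * T_mon (Word ls) + xx * S_mon (Word ls) + 2 * (bb * T_mon (Word ls))"
    by (subst T_mon_rec, subst (2) T_mon_rec) (simp add: S_mon_def coprod_Cons comp_def kappa_mon_simps
      nu_mon_simps mult.assoc sum_list_const_mult distrib_left distrib_right sum_list_addf)
qed

lemma lin_T: "lin T" and lin_S: "lin S"
  by (simp_all add: T_def S_def lin_lin_ext)

lemma T_one: "T 1 = 1" and S_one: "S 1 = 0"
  by (metis T_def T_mon_simps(1) lin_ext_mon mon_Nil) (metis S_def S_mon_simps(1) lin_ext_mon mon_Nil)

lemma xx_mult_mon: "xx * mon (Word ls) = mon (Word (LA # ls)) - mon (Word (LB # ls))"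
  by (simp add: mon_LA mon_LB)

lemmas T_linear = lin_add[OF lin_T] lin_scale[OF lin_T] lin_diff[OF lin_T]
lemmas S_linear = lin_add[OF lin_S] lin_scale[OF lin_S] lin_diff[OF lin_S]

lemmas lin_simps = lin_iff distrib_left scale_mult_left scale_mult_right ab.scale_right_distrib add_ac

lemma T_bb: "T (bb * u) = 2 * (bb * T u) + xx * S u"
proof (rule lin_eqI[where u = u])
  show "lin (\<lambda>u. T (bb * u))" "lin (\<lambda>u. 2 * (bb * T u) + xx * S u)"
    by (simp_all add: lin_simps T_linear S_linear)
qed (simp add: T_def S_def lin_ext_mon T_mon_simps flip: mon_LB)

lemma S_bb: "S (bb * u) = bb * T u"
proof (rule lin_eqI[where u = u])
  show "lin (\<lambda>u. S (bb * u))" "lin (\<lambda>u. bb * T u)"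
    by (simp_all add: lin_simps T_linear S_linear)
qed (simp add: T_def S_def lin_ext_mon S_mon_simps flip: mon_LB)

text \<open>
  Passing from \<open>a\<close> to \<open>x = a - b\<close> cancels all the terms that the two recursions on words share.
\<close>

lemma T_xx: "T (xx * u) = xx * T u"
proof (rule lin_eqI[where u = u])
  show "lin (\<lambda>u. T (xx * u))" "lin (\<lambda>u. xx * T u)"
    by (simp_all add: lin_simps T_linear)
  show "T (xx * mon (Word ls)) = xx * T (mon (Word ls))" for ls
    unfolding xx_mult_mon T_linear by (simp add: T_def lin_ext_mon T_mon_simps)
qed

lemma S_xx: "S (xx * u) = xx * S u"
proof (rule lin_eqI[where u = u])
  show "lin (\<lambda>u. S (xx * u))" "lin (\<lambda>u. xx * S u)"
    by (simp_all add: lin_simps S_linear)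
  show "S (xx * mon (Word ls)) = xx * S (mon (Word ls))" for ls
    unfolding xx_mult_mon S_linear by (simp add: S_def lin_ext_mon S_mon_simps)
qed


section \<open>The Tchebyshev transform of the second kind\<close>

lemma lin_H_star: "lin H_star"
  by (simp add: H_star_def lin_lin_ext)

lemma fixes u :: "'k::field ab"
  shows H_star_aa: "H_star (u * aa) = u" and H_star_bb: "H_star (u * bb) = u"
proof -
  have lin: "lin (\<lambda>u. H_star (u * v))" for v :: "'k ab"
    by (simp add: lin_iff distrib_right scale_mult_left lin_add[OF lin_H_star] lin_scale[OF lin_H_star])
  have mon: "H_star (mon (Word ls) * aa) = (mon (Word ls) :: 'k ab)"
    "H_star (mon (Word ls) * bb) = (mon (Word ls) :: 'k ab)" for ls
    by (simp_all add: aa_def bb_def mon_mult H_star_def lin_ext_mon plus_word_def zero_word_def)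
  show "H_star (u * aa) = u"
    using lin_eqI[of "\<lambda>u. H_star (u * aa)" "\<lambda>u. u" u] lin lin_ident mon(1) by simp
  show "H_star (u * bb) = u"
    using lin_eqI[of "\<lambda>u. H_star (u * bb)" "\<lambda>u. u" u] lin lin_ident mon(2) by simp
qed

text \<open>
  The polynomials without constant term. \<open>H_star\<close> strips the last letter of a word, so on them it
  commutes with every multiplication from the left; the description by the last letter makes this
  immediate.
\<close>

definition no_const :: "'k::field ab set" where
  "no_const = {p * aa + q * bb | p q. True}"

lemma no_constI: "u = p * aa + q * bb \<Longrightarrow> u \<in> no_const"
  unfolding no_const_def by blast

lemma H_star_mult: "u \<in> no_const \<Longrightarrow> H_star (v * u) = v * H_star u"
  by (auto simp: no_const_def distrib_left lin_add[OF lin_H_star] H_star_aa H_star_bb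
      simp flip: mult.assoc)

lemma no_const_add: "u \<in> no_const \<Longrightarrow> v \<in> no_const \<Longrightarrow> u + v \<in> no_const"
proof -
  assume "u \<in> no_const" "v \<in> no_const"
  then obtain p q p' q' where "u = p * aa + q * bb" "v = p' * aa + q' * bb"
    unfolding no_const_def by blast
  hence "u + v = (p + p') * aa + (q + q') * bb"
    by (simp add: distrib_right add_ac)
  thus ?thesis
    unfolding no_const_def by blast
qed

lemma no_const_mult: "u \<in> no_const \<Longrightarrow> v * u \<in> no_const"
proof -
  assume "u \<in> no_const"
  then obtain p q where "u = p * aa + q * bb"
    unfolding no_const_def by blast
  hence "v * u = (v * p) * aa + (v * q) * bb"
    by (simp add: distrib_left mult.assoc)
  thus ?thesis
    by (rule no_constI)
qed

lemma no_const_scale: "u \<in> no_const \<Longrightarrow> scale c u \<in> no_const"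
  using no_const_mult[of u "scale c 1"] by (simp add: scale_mult_left)

lemma aa_eq: "aa = xx + bb"
  by (simp add: xx_def)

lemma T_aa: "T (aa :: 'k::field ab) = xx + 2 * bb" and S_aa: "S (aa :: 'k ab) = bb"
proof -
  have "T (xx :: 'k ab) = xx" "T (bb :: 'k ab) = 2 * bb" "S (xx :: 'k ab) = 0" "S (bb :: 'k ab) = bb"
    using T_xx[of 1] T_bb[of 1] S_xx[of 1] S_bb[of 1] by (simp_all add: T_one S_one)
  thus "T (aa :: 'k ab) = xx + 2 * bb" "S (aa :: 'k ab) = bb"
    by (simp_all add: aa_eq T_linear S_linear)
qed

lemma T_S_no_const: "T (u * aa) \<in> no_const \<and> S (u * aa) \<in> no_const"
proof (induction u rule: xb_induct)
  case one
  have "T (1 * aa :: 'a ab) \<in> no_const"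
    by (rule no_constI[of _ 1 1]) (simp only: mult_1_left T_aa, simp add: aa_eq mult_2)
  moreover have "S (1 * aa :: 'a ab) \<in> no_const"
    by (rule no_constI[of _ 0 1]) (simp add: S_aa)
  ultimately show ?case ..
qed (simp_all add: distrib_right scale_mult_left lin_add[OF lin_T] lin_add[OF lin_S]
      lin_scale[OF lin_T] lin_scale[OF lin_S] no_const_add no_const_scale mult.assoc
      T_xx T_bb S_xx S_bb no_const_mult)

text \<open>
  \<open>V\<close> is to \<open>S\<close> as \<open>U\<close> is to \<open>T\<close>; it makes the recursion for \<open>U\<close> close up.
\<close>

definition V :: "'k::field ab \<Rightarrow> 'k ab" where
  "V u = H_star (S (u * aa))"

lemma lin_U: "lin U"
  unfolding U_def by (intro lin_comp[OF lin_H_star] lin_comp[OF lin_T] lin_mult_right lin_ident)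

lemma lin_V: "lin V"
  unfolding V_def by (intro lin_comp[OF lin_H_star] lin_comp[OF lin_S] lin_mult_right lin_ident)

lemma U_one: "U 1 = 2" and V_one: "V 1 = 1"
proof -
  have "U 1 = H_star (1 * aa + 1 * bb)"
    unfolding U_def mult_1_left T_aa by (simp add: aa_eq mult_2 add_ac)
  thus "U 1 = 2"
    unfolding lin_add[OF lin_H_star] H_star_aa H_star_bb by simp
  show "V 1 = 1"
    using H_star_bb[of 1] by (simp add: V_def S_aa)
qed

lemma U_xx: "U (xx * u) = xx * U u"
  and V_xx: "V (xx * u) = xx * V u"
  and U_bb: "U (bb * u) = 2 * (bb * U u) + xx * V u"
  and V_bb: "V (bb * u) = bb * U u"
  using T_S_no_const[of u]
  by (simp_all add: U_def V_def mult.assoc T_xx S_xx T_bb S_bb H_star_mult no_const_mult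
      lin_add[OF lin_H_star])


section \<open>The product operator\<close>

text \<open>
  Let \<open>u\<close> and \<open>v\<close> be the \<open>ab\<close>-indices of posets \<open>P\<close> and \<open>Q\<close>. The nontrivial chains in \<open>P \<times> Q\<close> are
  sorted by whether their first step changes the first coordinate only, the second only, or both,
  and each class contributes a bilinear expression in \<open>u\<close> and \<open>v\<close>. Multiplying \<open>u\<close> by \<open>x\<close> lengthens
  the first step in \<open>P\<close>, which lengthens a first step in \<open>P \<times> Q\<close> that involves \<open>P\<close>; a leading \<open>b\<close>
  says that the first step has length 1, after which any chain in the product may follow. In the
  third class the lengths of the two steps add up; as a step of length \<open>r\<close> has weight \<open>x\<^sup>r\<^sup>-\<^sup>1\<close>,
  this brings in an additional \<open>x\<close>.

  Since a bilinear operator is prescribed on pairs of words in \<open>a\<close> and \<open>b\<close>, the rules for \<open>x\<close> and for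
  \<open>b\<close> have to be combined into one for \<open>a = x + b\<close>. The value of \<open>first_both_b\<close> at \<open>u\<close> and \<open>v\<close> is that
  of \<open>first_both\<close> at \<open>b u\<close> and \<open>v\<close>.
\<close>

fun first_left first_right first_both first_both_b ::
    "letter list \<Rightarrow> letter list \<Rightarrow> 'k::field ab" where
  "first_left [] v = bb * mon (Word v)"
| "first_left (l # u) v = (if l = LA then xx * first_left u v else 0)
     + bb * (first_left u v + first_right u v + first_both u v)"
| "first_right u [] = bb * mon (Word u)"
| "first_right u (l # v) = (if l = LA then xx * first_right u v else 0)
     + bb * (first_left u v + first_right u v + first_both u v)"
| "first_both [] [] = xx"
| "first_both [] (l # v) = (if l = LA then xx * first_both [] v else 0) + xx * (bb * mon (Word v))"
| "first_both (l # u) v = (if l = LA then xx * first_both u v else 0) + first_both_b u v"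
| "first_both_b u [] = xx * (bb * mon (Word u))"
| "first_both_b u (l # v) = (if l = LA then xx * first_both_b u v else 0)
     + xx * (bb * (first_left u v + first_right u v + first_both u v))"

definition bilin_ext :: "(letter list \<Rightarrow> letter list \<Rightarrow> 'k::field ab) \<Rightarrow> 'k ab \<Rightarrow> 'k ab \<Rightarrow> 'k ab" where
  "bilin_ext f u v = lin_ext (\<lambda>w. lin_ext (\<lambda>w'. f (letters w) (letters w')) v) u"

lemma bilin_ext_mon: "bilin_ext f (mon (Word u)) (mon (Word v)) = f u v"
  by (simp add: bilin_ext_def lin_ext_mon)

lemma bilinear_op_lin:
  assumes "bilinear_op F"
  shows "lin (\<lambda>u. F u v)" "lin (F u)"
  using assms by (simp_all add: bilinear_op_def)

lemma bilinear_op_simps: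
  assumes "bilinear_op F"
  shows "F (u + u') v = F u v + F u' v" "F (u - u') v = F u v - F u' v" "F (scale c u) v = scale c (F u v)"
    "F u (v + v') = F u v + F u v'" "F u (v - v') = F u v - F u v'" "F u (scale c v) = scale c (F u v)"
proof -
  note l = bilinear_op_lin(1)[OF assms, of v] and r = bilinear_op_lin(2)[OF assms, of u]
  show "F (u + u') v = F u v + F u' v" "F (u - u') v = F u v - F u' v" "F (scale c u) v = scale c (F u v)"
    by (rule lin_add[OF l] lin_diff[OF l] lin_scale[OF l])+
  show "F u (v + v') = F u v + F u v'" "F u (v - v') = F u v - F u v'" "F u (scale c v) = scale c (F u v)"
    by (rule lin_add[OF r] lin_diff[OF r] lin_scale[OF r])+
qed

lemma bilinear_opI:
  assumes "\<And>u u' v. F (u + u') v = F u v + F u' v" "\<And>c u v. F (scale c u) v = scale c (F u v)"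
    "\<And>u v v'. F u (v + v') = F u v + F u v'" "\<And>c u v. F u (scale c v) = scale c (F u v)"
  shows "bilinear_op F"
  unfolding bilinear_op_def lin_iff using assms by blast

lemma bilinear_bilin_ext: "bilinear_op (bilin_ext f)"
proof (rule bilinear_opI)
  fix u v v' c
  show "bilin_ext f u (v + v') = bilin_ext f u v + bilin_ext f u v'"
    unfolding bilin_ext_def lin_add[OF lin_lin_ext]
    by (simp add: lin_ext_def ab.scale_right_distrib sum.distrib)
  show "bilin_ext f u (scale c v) = scale c (bilin_ext f u v)"
    unfolding bilin_ext_def lin_scale[OF lin_lin_ext]
    by (simp add: lin_ext_def ab.scale_sum_right mult.left_commute)
qed (simp_all add: bilin_ext_def lin_add[OF lin_lin_ext] lin_scale[OF lin_lin_ext])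

lemma bilin_eqI:
  assumes "bilinear_op F" "bilinear_op G"
    "\<And>u v. F (mon (Word u)) (mon (Word v)) = G (mon (Word u)) (mon (Word v))"
  shows "F u v = G u v"
proof -
  have "F (mon (Word u)) v = G (mon (Word u)) v" for u
    by (rule lin_eqI[OF bilinear_op_lin(2)[OF assms(1)] bilinear_op_lin(2)[OF assms(2)]]) (rule assms(3))
  thus ?thesis
    by (rule lin_eqI[OF bilinear_op_lin(1)[OF assms(1)] bilinear_op_lin(1)[OF assms(2)]])
qed

definition L_part :: "'k::field ab \<Rightarrow> 'k ab \<Rightarrow> 'k ab" where
  "L_part = bilin_ext first_left"

definition R_part :: "'k::field ab \<Rightarrow> 'k ab \<Rightarrow> 'k ab" where
  "R_part = bilin_ext first_right"

definition LR_part :: "'k::field ab \<Rightarrow> 'k ab \<Rightarrow> 'k ab" where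
  "LR_part = bilin_ext first_both"

definition prod_op :: "'k::field ab \<Rightarrow> 'k ab \<Rightarrow> 'k ab" where
  "prod_op u v = L_part u v + R_part u v + LR_part u v"

lemma bilinear_parts: "bilinear_op L_part" "bilinear_op R_part" "bilinear_op LR_part"
  unfolding L_part_def R_part_def LR_part_def by (rule bilinear_bilin_ext)+

lemmas parts_simps = bilinear_parts[THEN bilinear_op_simps(1)] bilinear_parts[THEN bilinear_op_simps(2)]
  bilinear_parts[THEN bilinear_op_simps(3)] bilinear_parts[THEN bilinear_op_simps(4)]
  bilinear_parts[THEN bilinear_op_simps(5)] bilinear_parts[THEN bilinear_op_simps(6)]

lemma bilinear_prod_op: "bilinear_op prod_op"
  by (rule bilinear_opI) (simp_all add: prod_op_def parts_simps ab.scale_right_distrib)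

lemmas prod_op_simps = bilinear_op_simps[OF bilinear_prod_op]

lemma parts_mon:
  "L_part (mon (Word u)) (mon (Word v)) = first_left u v"
  "R_part (mon (Word u)) (mon (Word v)) = first_right u v"
  "LR_part (mon (Word u)) (mon (Word v)) = first_both u v"
  "prod_op (mon (Word u)) (mon (Word v)) = first_left u v + first_right u v + first_both u v"
  by (simp_all add: prod_op_def L_part_def R_part_def LR_part_def bilin_ext_mon)

lemmas bilin_simps = parts_simps prod_op_simps distrib_left distrib_right
  scale_mult_left scale_mult_right ab.scale_right_distrib

text \<open>
  \<open>first_both\<close> recurses on its first argument, so that \<open>x\<close> can be pulled out of the second one needs an
  induction.
\<close>

lemma first_both_xx_right:
  "first_both u (LA # v) - first_both u (LB # v) = xx * first_both u v"
  by (induction u) (auto simp: algebra_simps)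

text \<open>
  Together with bilinearity, the following rules for \<open>x\<close>, \<open>b\<close> and \<open>1\<close> determine the three parts.
\<close>

lemma L_part_xx: "L_part (xx * u) v = xx * L_part u v"
  by (rule bilin_eqI[of "\<lambda>u. L_part (xx * u)" "\<lambda>u v. xx * L_part u v" u v],
      (rule bilinear_opI; simp add: bilin_simps)+)
    (simp add: xx_mult_mon parts_simps parts_mon)

lemma R_part_xx: "R_part u (xx * v) = xx * R_part u v"
  by (rule bilin_eqI[of "\<lambda>u v. R_part u (xx * v)" "\<lambda>u v. xx * R_part u v" u v],
      (rule bilinear_opI; simp add: bilin_simps)+)
    (simp add: xx_mult_mon parts_simps parts_mon)

lemma LR_part_xx_left: "LR_part (xx * u) v = xx * LR_part u v"
  by (rule bilin_eqI[of "\<lambda>u. LR_part (xx * u)" "\<lambda>u v. xx * LR_part u v" u v],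
      (rule bilinear_opI; simp add: bilin_simps)+)
    (simp add: xx_mult_mon parts_simps parts_mon)

lemma LR_part_xx_right: "LR_part u (xx * v) = xx * LR_part u v"
  by (rule bilin_eqI[of "\<lambda>u v. LR_part u (xx * v)" "\<lambda>u v. xx * LR_part u v" u v],
      (rule bilinear_opI; simp add: bilin_simps)+)
    (simp add: xx_mult_mon parts_simps parts_mon first_both_xx_right)

lemma L_part_bb: "L_part (bb * u) v = bb * prod_op u v"
  by (rule bilin_eqI[of "\<lambda>u. L_part (bb * u)" "\<lambda>u v. bb * prod_op u v" u v],
      (rule bilinear_opI; simp add: bilin_simps)+)
    (simp add: parts_mon flip: mon_LB)

lemma R_part_bb: "R_part u (bb * v) = bb * prod_op u v"
  by (rule bilin_eqI[of "\<lambda>u v. R_part u (bb * v)" "\<lambda>u v. bb * prod_op u v" u v],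
      (rule bilinear_opI; simp add: bilin_simps)+)
    (simp add: parts_mon flip: mon_LB)

lemma LR_part_bb_bb: "LR_part (bb * u) (bb * v) = xx * (bb * prod_op u v)"
  by (rule bilin_eqI[of "\<lambda>u v. LR_part (bb * u) (bb * v)" "\<lambda>u v. xx * (bb * prod_op u v)" u v],
      (rule bilinear_opI; simp add: bilin_simps)+)
    (simp add: parts_mon flip: mon_LB)

lemma L_part_one: "L_part 1 v = bb * v"
  by (rule lin_eqI[of "L_part 1" "\<lambda>v. bb * v" v],
      (simp add: lin_iff bilin_simps)+)
    (simp add: parts_mon flip: mon_Nil)

lemma R_part_one: "R_part u 1 = bb * u"
  by (rule lin_eqI[of "\<lambda>u. R_part u 1" "\<lambda>u. bb * u" u],
      (simp add: lin_iff bilin_simps)+)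
    (simp add: parts_mon flip: mon_Nil)

lemma LR_part_bb_one: "LR_part (bb * u) 1 = xx * (bb * u)"
  by (rule lin_eqI[of "\<lambda>u. LR_part (bb * u) 1" "\<lambda>u. xx * (bb * u)" u],
      (simp add: lin_iff bilin_simps)+)
    (simp add: parts_mon flip: mon_Nil mon_LB)

lemma LR_part_one_bb: "LR_part 1 (bb * v) = xx * (bb * v)"
  by (rule lin_eqI[of "\<lambda>v. LR_part 1 (bb * v)" "\<lambda>v. xx * (bb * v)" v],
      (simp add: lin_iff bilin_simps)+)
    (simp add: parts_mon flip: mon_Nil mon_LB)

lemma LR_part_one_one: "LR_part 1 1 = xx"
  using parts_mon(3)[of "[]" "[]"] by (simp add: mon_Nil)

lemma L_part_xx_power: "L_part (xx ^ i * u) v = xx ^ i * L_part u v"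
  by (induction i) (simp_all add: mult.assoc L_part_xx)

lemma R_part_xx_power: "R_part u (xx ^ i * v) = xx ^ i * R_part u v"
  by (induction i) (simp_all add: mult.assoc R_part_xx)

lemma LR_part_xx_power: "LR_part (xx ^ i * u) (xx ^ j * v) = xx ^ (i + j) * LR_part u v"
proof -
  have "LR_part u (xx ^ j * v) = xx ^ j * LR_part u v"
    by (induction j) (simp_all add: mult.assoc LR_part_xx_right)
  thus ?thesis
    by (induction i) (simp_all add: mult.assoc LR_part_xx_left)
qed


section \<open>The \<open>ab\<close>-index of an upper interval\<close>

text \<open>
  The recursion for chain weights needs of a grading only that the rank is strictly monotone, and
  this, unlike the condition on covers, visibly passes to Cartesian products.
\<close>

locale ranked_poset =
  fixes P :: "'p poset" and bot top :: 'p
  assumes finite_elems: "finite (elems P)"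
    and order: "partial_order_on (elems P) (ord P)"
    and bot: "is_bot P bot"
    and top: "is_top P top"
    and rk_less: "(x, y) \<in> ord P \<Longrightarrow> x \<noteq> y \<Longrightarrow> rk P x < rk P y"
begin

lemma ord_elems: "(x, y) \<in> ord P \<Longrightarrow> x \<in> elems P \<and> y \<in> elems P"
  using partial_order_onD(4)[OF order] by blast

lemma ord_refl: "x \<in> elems P \<Longrightarrow> (x, x) \<in> ord P"
  using partial_order_onD(1)[OF order] by (simp add: refl_on_def)

lemma ord_trans: "(x, y) \<in> ord P \<Longrightarrow> (y, z) \<in> ord P \<Longrightarrow> (x, z) \<in> ord P"
  using partial_order_onD(2)[OF order] by (blast dest: transD)

lemma ord_antisym: "(x, y) \<in> ord P \<Longrightarrow> (y, x) \<in> ord P \<Longrightarrow> x = y"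
  using partial_order_onD(3)[OF order] by (blast dest: antisymD)

lemma bot_elem: "bot \<in> elems P" and bot_least: "x \<in> elems P \<Longrightarrow> (bot, x) \<in> ord P"
  using bot by (auto simp: is_bot_def)

lemma top_elem: "top \<in> elems P" and top_greatest: "x \<in> elems P \<Longrightarrow> (x, top) \<in> ord P"
  using top by (auto simp: is_top_def)

lemma is_bot_iff: "is_bot P x \<longleftrightarrow> x = bot"
  using bot bot_elem bot_least ord_antisym by (auto simp: is_bot_def)

lemma is_top_iff: "is_top P x \<longleftrightarrow> x = top"
  using top top_elem top_greatest ord_antisym by (auto simp: is_top_def)

lemma rk_le: "(x, y) \<in> ord P \<Longrightarrow> rk P x \<le> rk P y"
  using rk_less[of x y] by (cases "x = y") auto

text \<open>
  For \<open>p\<close> below the top element, \<open>psi p\<close> is the \<open>ab\<close>-index of the interval from \<open>p\<close> to the top.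
\<close>

definition ups :: "'p \<Rightarrow> 'p set" where
  "ups p = {q. (p, q) \<in> ord P \<and> p \<noteq> q}"

definition chains :: "'p \<Rightarrow> 'p list set" where
  "chains p = {xs. xs \<noteq> [] \<and> set xs \<subseteq> elems P \<and> hd xs = p \<and> last xs = top \<and>
     sorted_wrt (\<lambda>x y. (x, y) \<in> ord P \<and> x \<noteq> y) xs}"

definition psi :: "'p \<Rightarrow> 'k::field ab" where
  "psi p = (\<Sum>xs \<in> chains p. chain_weight P xs)"

lemma ups_elems: "q \<in> ups p \<Longrightarrow> q \<in> elems P"
  using ord_elems by (auto simp: ups_def)

lemma finite_ups: "finite (ups p)"
  by (rule finite_subset[OF _ finite_elems]) (use ups_elems in blast)

lemma ups_top: "ups top = {}"
  using ord_antisym ord_elems top_greatest by (auto simp: ups_def)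

lemma rk_ups: "q \<in> ups p \<Longrightarrow> rk P p < rk P q"
  using rk_less by (simp add: ups_def)

lemma finite_chains: "finite (chains p)"
proof (rule finite_subset[OF _ finite_subset_distinct[OF finite_elems]])
  have "distinct xs" if "sorted_wrt (\<lambda>x y. (x, y) \<in> ord P \<and> x \<noteq> y) xs" for xs
    using that by (induction xs) auto
  thus "chains p \<subseteq> {xs. set xs \<subseteq> elems P \<and> distinct xs}"
    by (auto simp: chains_def)
qed

lemma chains_top: "chains top = {[top]}"
proof
  show "chains top \<subseteq> {[top]}"
  proof
    fix xs assume xs: "xs \<in> chains top"
    then obtain ys where ys: "xs = top # ys"
      by (cases xs) (auto simp: chains_def)
    have "ys = []"
    proof (rule ccontr)
      assume "ys \<noteq> []"
      hence "top \<in> set ys"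
        using xs last_in_set[of ys] by (auto simp: chains_def ys)
      thus False
        using xs by (auto simp: chains_def ys)
    qed
    thus "xs \<in> {[top]}"
      by (simp add: ys)
  qed
qed (simp add: chains_def top_elem)

lemma chains_rec:
  assumes p: "p \<in> elems P" "p \<noteq> top"
  shows "chains p = (\<Union>q \<in> ups p. (#) p ` chains q)"
proof
  show "chains p \<subseteq> (\<Union>q \<in> ups p. (#) p ` chains q)"
  proof
    fix xs assume xs: "xs \<in> chains p"
    then obtain ys where ys: "xs = p # ys"
      by (cases xs) (auto simp: chains_def)
    with xs p obtain q zs where q: "ys = q # zs"
      by (cases ys) (auto simp: chains_def)
    have "q \<in> ups p" "ys \<in> chains q"
      using xs by (auto simp: chains_def ys q ups_def)
    thus "xs \<in> (\<Union>q \<in> ups p. (#) p ` chains q)"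
      using ys by blast
  qed
  show "(\<Union>q \<in> ups p. (#) p ` chains q) \<subseteq> chains p"
  proof safe
    fix q ys assume q: "q \<in> ups p" and ys: "ys \<in> chains q"
    then obtain zs where zs: "ys = q # zs"
      by (cases ys) (auto simp: chains_def)
    have "(p, z) \<in> ord P \<and> p \<noteq> z" if "z \<in> set ys" for z
    proof -
      have "(q, z) \<in> ord P"
        using that ys ord_refl[OF ups_elems[OF q]] by (auto simp: chains_def zs)
      thus ?thesis
        using q ord_trans ord_antisym by (auto simp: ups_def)
    qed
    thus "p # ys \<in> chains p"
      using ys p by (auto simp: chains_def zs)
  qed
qed

lemma chain_weight_Cons:
  assumes "ys \<in> chains q"
  shows "chain_weight P (p # ys)
    = xx ^ (rk P q - rk P p - 1) * (if q = top then 1 else bb * chain_weight P ys)"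
proof (cases "q = top")
  case True
  thus ?thesis
    using assms by (simp add: chains_top flip: xx_def)
next
  case False
  then obtain z zs where "ys = q # z # zs"
    using assms by (cases ys; cases "tl ys") (auto simp: chains_def)
  thus ?thesis
    using False by (simp add: mult.assoc flip: xx_def)
qed

text \<open>
  What follows the first step of a chain if this step leads to \<open>p\<close>. The letter \<open>b\<close> marks inner elements
  of a chain, hence the exception for the top element.
\<close>

definition bpsi :: "'p \<Rightarrow> 'k::field ab" where
  "bpsi p = (if p = top then 1 else bb * psi p)"

lemma psi_rec:
  assumes p: "p \<in> elems P" "p \<noteq> top"
  shows "(psi p :: 'k::field ab) = (\<Sum>q \<in> ups p. xx ^ (rk P q - rk P p - 1) * bpsi q)"
proof -
  have hd: "hd xs = q" if "xs \<in> chains q" for xs q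
    using that by (simp add: chains_def)
  have "psi p = (\<Sum>q \<in> ups p. \<Sum>xs \<in> (#) p ` chains q. chain_weight P xs :: 'k ab)"
    unfolding psi_def chains_rec[OF p]
    by (rule sum.UNION_disjoint) (auto simp: finite_ups finite_chains dest: hd)
  also have "\<dots> = (\<Sum>q \<in> ups p. \<Sum>ys \<in> chains q. chain_weight P (p # ys))"
    by (simp add: sum.reindex)
  also have "\<dots> = (\<Sum>q \<in> ups p. xx ^ (rk P q - rk P p - 1) * bpsi q)"
  proof (rule sum.cong[OF refl])
    fix q
    have "(\<Sum>ys \<in> chains q. chain_weight P (p # ys) :: 'k ab)
        = (\<Sum>ys \<in> chains q. xx ^ (rk P q - rk P p - 1) * (if q = top then 1 else bb * chain_weight P ys))"
      by (rule sum.cong) (simp_all only: chain_weight_Cons)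
    also have "\<dots> = xx ^ (rk P q - rk P p - 1) * bpsi q"
      by (cases "q = top") (simp_all add: bpsi_def chains_top psi_def sum_distrib_left)
    finally show "(\<Sum>ys \<in> chains q. chain_weight P (p # ys) :: 'k ab)
        = xx ^ (rk P q - rk P p - 1) * bpsi q" .
  qed
  finally show ?thesis .
qed

lemma ab_index_eq_psi: "ab_index P = psi bot"
  unfolding ab_index_def psi_def bounded_chains_def chains_def is_bot_iff is_top_iff ..

end

text \<open>
  If \<open>y\<close> does not cover \<open>x\<close>, an element strictly between them splits the interval into two smaller
  ones.
\<close>

lemma graded_poset_rk_less:
  assumes "graded_poset P" "(x, y) \<in> ord P" "x \<noteq> y"
  shows "rk P x < rk P y"
  using assms(2,3)
proof (induction "card {z. (x, z) \<in> ord P \<and> (z, y) \<in> ord P}" arbitrary: x y rule: less_induct)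
  case (less x y)
  have order: "partial_order_on (elems P) (ord P)" and fin: "finite (elems P)"
    using assms(1) by (auto simp: graded_poset_def)
  note order' = partial_order_onD[OF order]
  let ?I = "\<lambda>x y. {z. (x, z) \<in> ord P \<and> (z, y) \<in> ord P}"
  have fin: "finite (?I x y)" for x y
    by (rule finite_subset[OF _ fin]) (use order'(4) in blast)
  show ?case
  proof (cases "covers P y x")
    case True
    thus ?thesis
      using assms(1) by (auto simp: graded_poset_def)
  next
    case False
    then obtain z where z: "(x, z) \<in> ord P" "(z, y) \<in> ord P" "z \<noteq> x" "z \<noteq> y"
      using less.prems by (auto simp: covers_def)
    have tr: "trans (ord P)" and an: "antisym (ord P)"
      using order' by auto
    have "x \<in> ?I x y" "x \<notin> ?I z y" "y \<in> ?I x y" "y \<notin> ?I x z" "?I z y \<subseteq> ?I x y" "?I x z \<subseteq> ?I x y"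
      using z less.prems order'(1,4) tr an
      by (auto simp: refl_on_def dest: antisymD transD)
    hence "?I z y \<subset> ?I x y" "?I x z \<subset> ?I x y"
      by blast+
    hence "card (?I z y) < card (?I x y)" "card (?I x z) < card (?I x y)"
      by (auto intro: psubset_card_mono[OF fin])
    hence "rk P x < rk P z" "rk P z < rk P y"
      using less.hyps z by auto
    thus ?thesis
      by simp
  qed
qed

lemma ranked_poset_if_graded:
  assumes "graded_poset P" "rank_ge_1 P"
  obtains bot top where "ranked_poset P bot top" "bot \<noteq> top"
proof -
  obtain bot top where bt: "is_bot P bot" "rk P bot = 0" "is_top P top"
    using assms(1) by (auto simp: graded_poset_def)
  hence "ranked_poset P bot top"
    using assms(1) graded_poset_rk_less[OF assms(1)]
    by unfold_locales (auto simp: graded_poset_def)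
  moreover have "bot \<noteq> top"
    using assms(2) bt by (auto simp: rank_ge_1_def)
  ultimately show ?thesis
    using that by blast
qed


section \<open>The \<open>ab\<close>-index of a product\<close>

locale two_ranked_posets = P: ranked_poset P bot top + Q: ranked_poset Q bot' top'
  for P :: "'p poset" and bot top and Q :: "'q poset" and bot' top'
begin

lemma ord_prod:
  "((x, y), (x', y')) \<in> ord (poset_prod P Q) \<longleftrightarrow> (x, x') \<in> ord P \<and> (y, y') \<in> ord Q"
  by (simp add: poset_prod_def)

lemma rk_prod: "rk (poset_prod P Q) (x, y) = rk P x + rk Q y"
  by (simp add: poset_prod_def)

lemma elems_prod: "elems (poset_prod P Q) = elems P \<times> elems Q"
  by (simp add: poset_prod_def)

sublocale PQ: ranked_poset "poset_prod P Q" "(bot, bot')" "(top, top')"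
proof
  show "partial_order_on (elems (poset_prod P Q)) (ord (poset_prod P Q))"
    unfolding partial_order_on_def preorder_on_def
  proof (intro conjI)
    show "ord (poset_prod P Q) \<subseteq> elems (poset_prod P Q) \<times> elems (poset_prod P Q)"
      using P.ord_elems Q.ord_elems by (auto simp: poset_prod_def)
    show "refl_on (elems (poset_prod P Q)) (ord (poset_prod P Q))"
      by (auto simp: refl_on_def elems_prod ord_prod P.ord_refl Q.ord_refl)
    show "trans (ord (poset_prod P Q))"
      by (rule transI) (auto simp: ord_prod intro: P.ord_trans Q.ord_trans)
    show "antisym (ord (poset_prod P Q))"
      by (rule antisymI) (auto simp: ord_prod intro: P.ord_antisym Q.ord_antisym)
  qed
  show "rk (poset_prod P Q) x < rk (poset_prod P Q) y"
    if "(x, y) \<in> ord (poset_prod P Q)" "x \<noteq> y" for x y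
  proof -
    obtain x1 x2 y1 y2 where xy: "x = (x1, x2)" "y = (y1, y2)"
      by (cases x, cases y)
    show ?thesis
      using that P.rk_le[of x1 y1] P.rk_less[of x1 y1] Q.rk_le[of x2 y2] Q.rk_less[of x2 y2]
      by (cases "x1 = y1") (auto simp: xy ord_prod rk_prod)
  qed
qed (auto simp: is_bot_def is_top_def elems_prod ord_prod P.finite_elems Q.finite_elems
      P.bot_elem Q.bot_elem P.bot_least Q.bot_least P.top_elem Q.top_elem P.top_greatest Q.top_greatest)

lemma ups_prod:
  assumes "p \<in> elems P" "q \<in> elems Q"
  shows "PQ.ups (p, q) = (\<lambda>p'. (p', q)) ` P.ups p \<union> Pair p ` Q.ups q \<union> P.ups p \<times> Q.ups q"
  using assms by (auto simp: PQ.ups_def P.ups_def Q.ups_def ord_prod P.ord_refl Q.ord_refl)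

lemma sum_ups_prod:
  assumes "p \<in> elems P" "q \<in> elems Q"
  shows "(\<Sum>r \<in> PQ.ups (p, q). f r)
    = (\<Sum>p' \<in> P.ups p. f (p', q)) + (\<Sum>q' \<in> Q.ups q. f (p, q'))
      + (\<Sum>p' \<in> P.ups p. \<Sum>q' \<in> Q.ups q. f (p', q'))"
proof -
  have "(\<Sum>r \<in> PQ.ups (p, q). f r) = (\<Sum>r \<in> (\<lambda>p'. (p', q)) ` P.ups p. f r)
      + (\<Sum>r \<in> Pair p ` Q.ups q. f r) + (\<Sum>r \<in> P.ups p \<times> Q.ups q. f r)"
    unfolding ups_prod[OF assms]
    by (subst sum.union_disjoint, use P.finite_ups Q.finite_ups in \<open>auto simp: P.ups_def Q.ups_def\<close>)+
  thus ?thesis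
    by (simp add: sum.reindex inj_on_def sum.cartesian_product)
qed

text \<open>
  The intervals above \<open>(top, q)\<close> and above \<open>q\<close> are isomorphic.
\<close>

lemma psi_top_left:
  assumes "q \<in> elems Q" "q \<noteq> top'"
  shows "(PQ.psi (top, q) :: 'k::field ab) = Q.psi q"
  using assms
proof (induction "rk Q top' - rk Q q" arbitrary: q rule: less_induct)
  case (less q)
  have bpsi: "(PQ.bpsi (top, q') :: 'k ab) = Q.bpsi q'" if "q' \<in> Q.ups q" for q'
  proof (cases "q' = top'")
    case False
    have "rk Q q' \<le> rk Q top'"
      by (intro Q.rk_le Q.top_greatest Q.ups_elems[OF that])
    thus ?thesis
      using less.hyps[of q'] Q.ups_elems[OF that] Q.rk_ups[OF that] False
      by (simp add: PQ.bpsi_def Q.bpsi_def)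
  qed (simp add: PQ.bpsi_def Q.bpsi_def)
  show ?case
    using less.prems
    by (simp add: PQ.psi_rec Q.psi_rec elems_prod P.top_elem sum_ups_prod P.ups_top rk_prod bpsi
        cong: sum.cong)
qed

lemma psi_top_right:
  assumes "p \<in> elems P" "p \<noteq> top"
  shows "(PQ.psi (p, top') :: 'k::field ab) = P.psi p"
  using assms
proof (induction "rk P top - rk P p" arbitrary: p rule: less_induct)
  case (less p)
  have bpsi: "(PQ.bpsi (p', top') :: 'k ab) = P.bpsi p'" if "p' \<in> P.ups p" for p'
  proof (cases "p' = top")
    case False
    have "rk P p' \<le> rk P top"
      by (intro P.rk_le P.top_greatest P.ups_elems[OF that])
    thus ?thesis
      using less.hyps[of p'] P.ups_elems[OF that] P.rk_ups[OF that] False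
      by (simp add: PQ.bpsi_def P.bpsi_def)
  qed (simp add: PQ.bpsi_def P.bpsi_def)
  show ?case
    using less.prems
    by (simp add: PQ.psi_rec P.psi_rec elems_prod Q.top_elem sum_ups_prod Q.ups_top rk_prod bpsi
        cong: sum.cong)
qed

text \<open>
  Expand both arguments of \<open>prod_op\<close> by \<open>psi_rec\<close>, with only the argument that moves being expanded in
  the first two parts. The rules for the three parts turn the products of first steps into the
  first steps from \<open>(p, q)\<close>; the exceptional rules for the argument \<open>1\<close> correspond to first steps that
  reach the top element in one coordinate.
\<close>

lemma psi_prod:
  assumes "p \<in> elems P" "p \<noteq> top" "q \<in> elems Q" "q \<noteq> top'"
  shows "(PQ.psi (p, q) :: 'k::field ab) = prod_op (P.psi p) (Q.psi q)"
  using assms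
proof (induction "(rk P top - rk P p) + (rk Q top' - rk Q q)" arbitrary: p q rule: less_induct)
  case (less p q)
  note elems = less.prems(1,3) and ne = less.prems(2,4)
  have rkP: "rk P p < rk P p'" "rk P p' \<le> rk P top" "p' \<in> elems P" if "p' \<in> P.ups p" for p'
    using P.rk_ups[OF that] P.ups_elems[OF that] by (auto intro: P.rk_le P.top_greatest)
  have rkQ: "rk Q q < rk Q q'" "rk Q q' \<le> rk Q top'" "q' \<in> elems Q" if "q' \<in> Q.ups q" for q'
    using Q.rk_ups[OF that] Q.ups_elems[OF that] by (auto intro: Q.rk_le Q.top_greatest)
  have left: "L_part (P.bpsi p') (Q.psi q :: 'k ab) = PQ.bpsi (p', q)" if p': "p' \<in> P.ups p" for p'
  proof (cases "p' = top")
    case True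
    thus ?thesis
      using elems ne by (simp add: P.bpsi_def PQ.bpsi_def L_part_one psi_top_left)
  next
    case False
    thus ?thesis
      using less.hyps[of p' q] rkP[OF p'] elems ne
      by (simp add: P.bpsi_def PQ.bpsi_def L_part_bb)
  qed
  have right: "R_part (P.psi p :: 'k ab) (Q.bpsi q') = PQ.bpsi (p, q')" if q': "q' \<in> Q.ups q" for q'
  proof (cases "q' = top'")
    case True
    thus ?thesis
      using elems ne by (simp add: Q.bpsi_def PQ.bpsi_def R_part_one psi_top_right)
  next
    case False
    thus ?thesis
      using less.hyps[of p q'] rkQ[OF q'] elems ne
      by (simp add: Q.bpsi_def PQ.bpsi_def R_part_bb)
  qed
  have both: "LR_part (P.bpsi p' :: 'k ab) (Q.bpsi q') = xx * PQ.bpsi (p', q')"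
    if p': "p' \<in> P.ups p" and q': "q' \<in> Q.ups q" for p' q'
  proof -
    have "(PQ.psi (p', q') :: 'k ab) = prod_op (P.psi p') (Q.psi q')" if "p' \<noteq> top" "q' \<noteq> top'"
      using less.hyps[of p' q'] rkP[OF p'] rkQ[OF q'] that by simp
    thus ?thesis
      using rkP[OF p'] rkQ[OF q']
      by (simp add: P.bpsi_def Q.bpsi_def PQ.bpsi_def LR_part_one_one LR_part_one_bb LR_part_bb_one
          LR_part_bb_bb psi_top_left psi_top_right)
  qed
  have "L_part (P.psi p :: 'k ab) (Q.psi q)
      = (\<Sum>p' \<in> P.ups p. xx ^ (rk P p' - rk P p - 1) * PQ.bpsi (p', q))"
    using elems ne
    by (subst P.psi_rec) (simp_all add: lin_sum[OF bilinear_op_lin(1)[OF bilinear_parts(1)]]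
        L_part_xx_power left cong: sum.cong)
  moreover have "R_part (P.psi p :: 'k ab) (Q.psi q)
      = (\<Sum>q' \<in> Q.ups q. xx ^ (rk Q q' - rk Q q - 1) * PQ.bpsi (p, q'))"
    using elems ne
    by (subst Q.psi_rec) (simp_all add: lin_sum[OF bilinear_op_lin(2)[OF bilinear_parts(2)]]
        R_part_xx_power right cong: sum.cong)
  moreover have "LR_part (P.psi p :: 'k ab) (Q.psi q)
      = (\<Sum>p' \<in> P.ups p. \<Sum>q' \<in> Q.ups q.
          xx ^ (rk P p' + rk Q q' - (rk P p + rk Q q) - 1) * PQ.bpsi (p', q'))"
  proof -
    have pow: "xx ^ (rk P p' - rk P p - 1 + (rk Q q' - rk Q q - 1)) * (xx * PQ.bpsi (p', q'))
        = xx ^ (rk P p' + rk Q q' - (rk P p + rk Q q) - 1) * (PQ.bpsi (p', q') :: 'k ab)"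
      if p': "p' \<in> P.ups p" and q': "q' \<in> Q.ups q" for p' q'
    proof -
      \<comment> \<open>The exponents of the two first steps are each diminished by 1; the factor \<open>xx\<close> makes up for it.\<close>
      have "rk P p' + rk Q q' - (rk P p + rk Q q) - 1
          = Suc (rk P p' - rk P p - 1 + (rk Q q' - rk Q q - 1))"
        using rkP(1)[OF p'] rkQ(1)[OF q'] by simp
      thus ?thesis
        by (simp only: power_Suc2 mult.assoc)
    qed
    have "LR_part (P.psi p :: 'k ab) (Q.psi q) = (\<Sum>p' \<in> P.ups p. \<Sum>q' \<in> Q.ups q.
        LR_part (xx ^ (rk P p' - rk P p - 1) * P.bpsi p') (xx ^ (rk Q q' - rk Q q - 1) * Q.bpsi q'))"
      unfolding P.psi_rec[OF elems(1) ne(1)] Q.psi_rec[OF elems(2) ne(2)]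
        lin_sum[OF bilinear_op_lin(1)[OF bilinear_parts(3)]]
        lin_sum[OF bilinear_op_lin(2)[OF bilinear_parts(3)]] by (rule sum.swap)
    also have "\<dots> = (\<Sum>p' \<in> P.ups p. \<Sum>q' \<in> Q.ups q.
          xx ^ (rk P p' + rk Q q' - (rk P p + rk Q q) - 1) * PQ.bpsi (p', q'))"
      by (intro sum.cong refl) (simp only: LR_part_xx_power both pow)
    finally show ?thesis .
  qed
  moreover have "(PQ.psi (p, q) :: 'k ab)
      = (\<Sum>r \<in> PQ.ups (p, q). xx ^ (rk (poset_prod P Q) r - rk (poset_prod P Q) (p, q) - 1) * PQ.bpsi r)"
    using elems ne by (intro PQ.psi_rec) (auto simp: elems_prod)
  ultimately show ?case
    by (simp add: prod_op_def sum_ups_prod[OF elems] rk_prod)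
qed

end

lemma ab_index_prod:
  assumes "graded_poset P" "rank_ge_1 P" "graded_poset Q" "rank_ge_1 Q"
  shows "ab_index (poset_prod P Q) = prod_op (ab_index P) (ab_index Q)"
proof -
  obtain bot top where P: "ranked_poset P bot top" "bot \<noteq> top"
    using assms ranked_poset_if_graded by blast
  obtain bot' top' where Q: "ranked_poset Q bot' top'" "bot' \<noteq> top'"
    using assms ranked_poset_if_graded by blast
  interpret two_ranked_posets P bot top Q bot' top'
    using P Q by (simp add: two_ranked_posets_def)
  show ?thesis
    using psi_prod[of bot bot'] P Q
    by (simp add: PQ.ab_index_eq_psi P.ab_index_eq_psi Q.ab_index_eq_psi P.bot_elem Q.bot_elem)
qed


section \<open>Posets whose \<open>ab\<close>-indices span\<close>

text \<open>
  The ranks are \<open>0, ..., n + 1\<close>; rank \<open>i\<close> consists of \<open>2 i\<close> and, if \<open>i \<in> D\<close>, also of \<open>2 i + 1\<close>. Elements of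
  different ranks are always comparable.
\<close>

definition layered_poset :: "nat \<Rightarrow> nat set \<Rightarrow> nat poset" where
  "layered_poset n D =
     (let E = {x. x \<le> Suc (Suc (2 * n)) \<and> (odd x \<longrightarrow> x div 2 \<in> D)} in
      \<lparr> elems = E,
        ord = {(x, y). x \<in> E \<and> y \<in> E \<and> (x = y \<or> x div 2 < y div 2)},
        rk = (\<lambda>x. x div 2) \<rparr>)"

lemma layered_poset_simps:
  "x \<in> elems (layered_poset n D) \<longleftrightarrow> x \<le> Suc (Suc (2 * n)) \<and> (odd x \<longrightarrow> x div 2 \<in> D)"
  "(x, y) \<in> ord (layered_poset n D) \<longleftrightarrow>
    x \<in> elems (layered_poset n D) \<and> y \<in> elems (layered_poset n D) \<and> (x = y \<or> x div 2 < y div 2)"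
  "rk (layered_poset n D) x = x div 2"
  by (simp_all add: layered_poset_def Let_def)

context
  fixes n :: nat and D :: "nat set"
  assumes D: "D \<subseteq> {1..n}"
begin

lemma layered_order: "partial_order_on (elems (layered_poset n D)) (ord (layered_poset n D))"
  unfolding partial_order_on_def preorder_on_def
proof (intro conjI)
  show "refl_on (elems (layered_poset n D)) (ord (layered_poset n D))"
    by (rule refl_onI) (simp add: layered_poset_simps(2))
  show "trans (ord (layered_poset n D))"
    by (rule transI) (auto simp: layered_poset_simps(2))
  show "antisym (ord (layered_poset n D))"
    by (rule antisymI) (auto simp: layered_poset_simps(2))
qed (auto simp: layered_poset_simps(2))

lemma layered_bot: "is_bot (layered_poset n D) 0"
proof -
  have "0 < y div 2" if "y \<in> elems (layered_poset n D)" "y \<noteq> 0" for y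
  proof (cases "y = 1")
    case True
    thus ?thesis
      using that D by (auto simp: layered_poset_simps)
  next
    case False
    thus ?thesis
      using that by simp
  qed
  moreover have "0 \<in> elems (layered_poset n D)"
    by (simp add: layered_poset_simps(1))
  ultimately show ?thesis
    unfolding is_bot_def layered_poset_simps(2) div_0 by metis
qed

lemma layered_top: "is_top (layered_poset n D) (Suc (Suc (2 * n)))"
proof -
  have "y div 2 < n + 1" if "y \<in> elems (layered_poset n D)" "y \<noteq> Suc (Suc (2 * n))" for y
    using that by (auto simp: layered_poset_simps)
  moreover have "Suc (Suc (2 * n)) \<in> elems (layered_poset n D)"
    by (simp add: layered_poset_simps(1))
  ultimately show ?thesis
    unfolding is_top_def layered_poset_simps(2) by auto
qed

lemma finite_layered: "finite (elems (layered_poset n D))"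
  by (rule finite_subset[of _ "{..Suc (Suc (2 * n))}"]) (auto simp: layered_poset_simps)

lemma ranked_layered: "ranked_poset (layered_poset n D) 0 (Suc (Suc (2 * n)))"
proof
  show "rk (layered_poset n D) x < rk (layered_poset n D) y"
    if "(x, y) \<in> ord (layered_poset n D)" "x \<noteq> y" for x y
    using that by (simp add: layered_poset_simps(2,3))
qed (fact finite_layered layered_order layered_bot layered_top)+

lemma graded_layered: "graded_poset (layered_poset n D)"
proof -
  have "rk (layered_poset n D) y = rk (layered_poset n D) x + 1"
    if c: "covers (layered_poset n D) y x" for x y
  proof (rule ccontr)
    define z where "z = 2 * (x div 2 + 1)"
    assume "rk (layered_poset n D) y \<noteq> rk (layered_poset n D) x + 1"
    moreover from c have xy: "x div 2 < y div 2" "x \<in> elems (layered_poset n D)" "y \<in> elems (layered_poset n D)"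
      by (auto simp: covers_def layered_poset_simps(2))
    ultimately have "x div 2 + 1 < y div 2"
      unfolding layered_poset_simps(3) by linarith
    moreover have "z div 2 = x div 2 + 1"
      by (simp add: z_def)
    ultimately have z: "x div 2 < z div 2" "z div 2 < y div 2"
      by linarith+
    have "y \<le> Suc (Suc (2 * n))"
      using xy(3) by (simp add: layered_poset_simps(1))
    hence "z \<le> Suc (Suc (2 * n))"
      using z by linarith
    hence "z \<in> elems (layered_poset n D)"
      by (simp add: layered_poset_simps(1) z_def)
    hence "(x, z) \<in> ord (layered_poset n D)" "(z, y) \<in> ord (layered_poset n D)"
      using xy z by (simp_all add: layered_poset_simps(2))
    hence "z = x \<or> z = y"
      using c by (simp add: covers_def)
    thus False
      using z by auto
  qed
  moreover have "rk (layered_poset n D) 0 = 0"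
    by (simp add: layered_poset_simps(3))
  ultimately show ?thesis
    using finite_layered layered_order layered_bot layered_top
    unfolding graded_poset_def by blast
qed

lemma rank_ge_1_layered: "rank_ge_1 (layered_poset n D)"
  using ranked_poset.is_top_iff[OF ranked_layered] by (simp add: rank_ge_1_def layered_poset_simps(3))

interpretation layered: ranked_poset "layered_poset n D" 0 "Suc (Suc (2 * n))"
  by (rule ranked_layered)

text \<open>
  A first step either goes up by one rank, to one of one or two elements, or is longer; in the
  second case it is a first step from an element of the next rank, lengthened by one. With \<open>m\<close>
  elements in the next rank this gives the factor \<open>m b + x\<close>, that is \<open>a\<close> or \<open>a + b\<close>.
\<close>

lemma psi_layered:
  assumes "p \<in> elems (layered_poset n D)" "p \<noteq> Suc (Suc (2 * n))"
  shows "(layered.psi p :: 'k::field ab)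
    = prod_list (map (\<lambda>i. if i \<in> D then aa + bb else aa) [Suc (p div 2)..<Suc n])"
  using assms
proof (induction "n - p div 2" arbitrary: p rule: less_induct)
  case (less p)
  let ?P = "layered_poset n D"
  define k where "k = p div 2"
  define rest where
    "rest m = (prod_list (map (\<lambda>i. if i \<in> D then aa + bb else aa) [Suc m..<Suc n]) :: 'k ab)" for m
  have rk: "rk ?P x = x div 2" for x
    by (rule layered_poset_simps(3))
  have k: "k \<le> n"
    using less.prems unfolding k_def layered_poset_simps(1) by linarith
  have ups: "r \<in> layered.ups q \<longleftrightarrow> r \<in> elems ?P \<and> q div 2 < r div 2" if "q \<in> elems ?P" for q r
    using that by (auto simp: layered.ups_def layered_poset_simps(2))
  have IH: "(layered.psi q :: 'k ab) = rest (k + 1)"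
    if "q \<in> elems ?P" "q \<noteq> Suc (Suc (2 * n))" "q div 2 = k + 1" "k < n" for q
    using less.hyps[of q] that by (simp add: rest_def k_def del: upt_Suc)
  have "(layered.psi p :: 'k ab) = rest k"
  proof (cases "k = n")
    case True
    have "r \<in> layered.ups p \<longleftrightarrow> r = Suc (Suc (2 * n))" for r
      unfolding ups[OF less.prems(1)] k_def[symmetric] True layered_poset_simps(1) by auto
    hence "layered.ups p = {Suc (Suc (2 * n))}"
      by blast
    thus ?thesis
      using True unfolding layered.psi_rec[OF less.prems] rk k_def[symmetric]
      by (simp add: layered.bpsi_def rest_def)
  next
    case False
    hence kn: "k < n"
      using k by simp
    \<comment> \<open>the element that is present in the next rank in any case\<close>
    define r where "r = 2 * (k + 1)"
    define layer where "layer = (if k + 1 \<in> D then {r, r + 1} else {r})"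
    have r: "r \<in> elems ?P" "r \<noteq> Suc (Suc (2 * n))" "r div 2 = k + 1"
      using kn by (simp_all add: layered_poset_simps(1) r_def)
    have layer: "q \<in> layer \<longleftrightarrow> q \<in> elems ?P \<and> q div 2 = k + 1" for q
    proof -
      have "q div 2 = k + 1 \<longleftrightarrow> q = r \<or> q = r + 1"
        unfolding r_def by presburger
      moreover have "r + 1 \<in> elems ?P \<longleftrightarrow> k + 1 \<in> D"
        using kn by (simp add: layered_poset_simps(1) r_def)
      ultimately show ?thesis
        using r(1) by (auto simp: layer_def)
    qed
    have fin: "finite layer"
      by (simp add: layer_def)
    have "q \<in> layered.ups p \<longleftrightarrow> q \<in> layer \<or> q \<in> layered.ups r" for q
      unfolding layer ups[OF less.prems(1)] ups[OF r(1)] r(3) k_def[symmetric] by auto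
    hence union: "layered.ups p = layer \<union> layered.ups r"
      by blast
    have disj: "layer \<inter> layered.ups r = {}"
      using layer ups[OF r(1)] r(3) by auto
    have "(layered.psi p :: 'k ab)
        = (\<Sum>q \<in> layer. xx ^ (q div 2 - k - 1) * layered.bpsi q)
          + (\<Sum>q \<in> layered.ups r. xx ^ (q div 2 - k - 1) * layered.bpsi q)"
      unfolding layered.psi_rec[OF less.prems] union rk k_def[symmetric]
      by (rule sum.union_disjoint[OF fin layered.finite_ups disj])
    also have "(\<Sum>q \<in> layer. xx ^ (q div 2 - k - 1) * layered.bpsi q) = (\<Sum>q \<in> layer. bb * rest (k + 1))"
    proof (rule sum.cong[OF refl])
      fix q assume "q \<in> layer"
      hence q: "q \<in> elems ?P" "q div 2 = k + 1"
        using layer by auto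
      hence "q \<noteq> Suc (Suc (2 * n))"
        using kn by auto
      thus "xx ^ (q div 2 - k - 1) * layered.bpsi q = bb * rest (k + 1)"
        using IH q kn by (simp add: layered.bpsi_def)
    qed
    also have "\<dots> = (if k + 1 \<in> D then bb * rest (k + 1) + bb * rest (k + 1) else bb * rest (k + 1))"
      by (simp add: layer_def mult_2)
    also have "(\<Sum>q \<in> layered.ups r. xx ^ (q div 2 - k - 1) * layered.bpsi q)
        = xx * (layered.psi r :: 'k ab)"
      unfolding layered.psi_rec[OF r(1,2)] sum_distrib_left rk r(3)
    proof (rule sum.cong[OF refl])
      fix q assume "q \<in> layered.ups r"
      hence "q div 2 - k - 1 = Suc (q div 2 - (k + 1) - 1)"
        using ups[OF r(1)] r(3) by auto
      thus "xx ^ (q div 2 - k - 1) * layered.bpsi q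
          = xx * (xx ^ (q div 2 - (k + 1) - 1) * (layered.bpsi q :: 'k ab))"
        by (simp only: power_Suc mult.assoc)
    qed
    also have "(layered.psi r :: 'k ab) = rest (k + 1)"
      by (rule IH[OF r kn])
    also have "(if k + 1 \<in> D then bb * rest (k + 1) + bb * rest (k + 1) else bb * rest (k + 1))
        + xx * rest (k + 1) = (if k + 1 \<in> D then aa + bb else aa) * rest (k + 1)"
      by (simp add: aa_eq distrib_right add_ac)
    also have "\<dots> = rest k"
    proof -
      have "[Suc k..<Suc n] = Suc k # [Suc (k + 1)..<Suc n]"
        using kn by (simp add: upt_conv_Cons del: upt_Suc)
      thus ?thesis
        unfolding rest_def by simp
    qed
    finally show ?thesis .
  qed
  thus ?case
    by (simp add: rest_def k_def del: upt_Suc)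
qed

lemma ab_index_layered:
  "(ab_index (layered_poset n D) :: 'k::field ab)
    = prod_list (map (\<lambda>i. if i \<in> D then aa + bb else aa) [1..<Suc n])"
  using psi_layered[of 0] by (simp add: layered.ab_index_eq_psi layered_poset_simps(1) del: upt_Suc)

end

definition layered_indices :: "'k::field ab set" where
  "layered_indices = range (\<lambda>ds. prod_list (map (\<lambda>d. if d then aa + bb else aa) ds))"

lemma layered_indicesE:
  assumes "(u :: 'k::field ab) \<in> layered_indices"
  obtains P :: "nat poset" where "graded_poset P" "rank_ge_1 P" "ab_index P = u"
proof -
  obtain ds where u: "u = prod_list (map (\<lambda>d. if d then aa + bb else aa) ds)"
    using assms by (auto simp: layered_indices_def)
  define D where "D = {i. 1 \<le> i \<and> i \<le> length ds \<and> ds ! (i - 1)}"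
  have D: "D \<subseteq> {1..length ds}"
    by (auto simp: D_def)
  have "map (\<lambda>i. if i \<in> D then aa + bb else aa :: 'k ab) [1..<Suc (length ds)]
      = map (\<lambda>d. if d then aa + bb else aa) ds"
    by (rule nth_equalityI) (auto simp: D_def simp del: upt_Suc)
  hence "ab_index (layered_poset (length ds) D) = u"
    using ab_index_layered[OF D] u by metis
  thus ?thesis
    using that graded_layered[OF D] rank_ge_1_layered[OF D] by blast
qed

text \<open>
  The span is closed under multiplication by \<open>a\<close> and \<open>a + b\<close> from the left, hence by \<open>b = (a + b) - a\<close>.
\<close>

lemma span_layered_indices: "ab.span (layered_indices :: 'k::field ab set) = UNIV"
proof -
  let ?G = "layered_indices :: 'k ab set"
  have prepend: "aa * g \<in> ?G \<and> (aa + bb) * g \<in> ?G" if "g \<in> ?G" for g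
  proof -
    obtain ds where g: "g = prod_list (map (\<lambda>d. if d then aa + bb else aa) ds)"
      using \<open>g \<in> ?G\<close> by (auto simp: layered_indices_def)
    show ?thesis
      unfolding layered_indices_def g
      by (auto intro: range_eqI[of _ _ "False # ds"] range_eqI[of _ _ "True # ds"])
  qed
  have mult: "aa * v \<in> ab.span ?G \<and> (aa + bb) * v \<in> ab.span ?G" if "v \<in> ab.span ?G" for v
    using that
  proof (induction rule: ab.span_induct_alt)
    case (step c x y)
    thus ?case
      using prepend[of x] unfolding distrib_left[of _ "scale c x"] scale_mult_right
      by (blast intro: ab.span_add ab.span_scale ab.span_base)
  qed (simp add: ab.span_zero)
  have mult_bb: "bb * v \<in> ab.span ?G" if "v \<in> ab.span ?G" for v
    using ab.span_diff[of "(aa + bb) * v" ?G "aa * v"] mult[OF that] by (simp add: distrib_right)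
  have "v \<in> ab.span ?G" for v
  proof (induction v rule: xb_induct)
    case one
    show ?case
      by (rule ab.span_base) (auto simp: layered_indices_def intro: range_eqI[of _ _ "[]"])
  next
    case (xx u)
    show ?case
      using ab.span_diff[of "aa * u" ?G "bb * u"] mult[OF xx] mult_bb[OF xx]
      by (simp add: xx_def left_diff_distrib)
  qed (auto intro: ab.span_add ab.span_scale mult_bb)
  thus ?thesis
    by auto
qed


section \<open>The operators \<open>M\<close> and \<open>Pyr\<close>\<close>

lemma lin_eq_on_span:
  assumes "lin f" "lin g" "\<And>u. u \<in> G \<Longrightarrow> f u = g u" "u \<in> ab.span G"
  shows "f u = g u"
  using assms(4)
  by (induction rule: ab.span_induct_alt)
    (simp_all add: assms(3) lin_zero[OF assms(1)] lin_zero[OF assms(2)] lin_add[OF assms(1)]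
      lin_add[OF assms(2)] lin_scale[OF assms(1)] lin_scale[OF assms(2)])

text \<open>
  Existence is \<open>ab_index_prod\<close>. Uniqueness holds because a bilinear operator is determined by its
  values on a spanning set.
\<close>

lemma M_eq_prod_op: "(M :: 'k::field ab \<Rightarrow> _) = prod_op"
  unfolding M_def
proof (rule the_equality)
  show "bilinear_op (prod_op :: 'k ab \<Rightarrow> _) \<and>
    (\<forall>(P :: nat poset) (Q :: nat poset). graded_poset P \<and> rank_ge_1 P \<and> graded_poset Q \<and> rank_ge_1 Q \<longrightarrow>
        ab_index (poset_prod P Q) = prod_op (ab_index P) (ab_index Q :: 'k ab))"
    using bilinear_prod_op ab_index_prod by blast
next
  fix F :: "'k ab \<Rightarrow> 'k ab \<Rightarrow> 'k ab"
  assume F: "bilinear_op F \<and>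
    (\<forall>(P :: nat poset) (Q :: nat poset). graded_poset P \<and> rank_ge_1 P \<and> graded_poset Q \<and> rank_ge_1 Q \<longrightarrow>
        ab_index (poset_prod P Q) = F (ab_index P) (ab_index Q))"
  hence bil: "bilinear_op F"
    by blast
  have in_span: "w \<in> ab.span (layered_indices :: 'k ab set)" for w
    by (simp add: span_layered_indices)
  have eq: "F u v = prod_op u v" if u: "u \<in> layered_indices" and v: "v \<in> layered_indices" for u v
  proof -
    obtain P :: "nat poset" where P: "graded_poset P" "rank_ge_1 P" "ab_index P = u"
      by (rule layered_indicesE[OF u])
    obtain Q :: "nat poset" where Q: "graded_poset Q" "rank_ge_1 Q" "ab_index Q = v"
      by (rule layered_indicesE[OF v])
    have "F u v = ab_index (poset_prod P Q)"
      using F P Q by metis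
    also have "\<dots> = prod_op u v"
      using ab_index_prod[OF P(1,2) Q(1,2)] P(3) Q(3) by metis
    finally show ?thesis .
  qed
  have eq2: "F u v = prod_op u v" if u: "u \<in> layered_indices" for u v
    by (rule lin_eq_on_span[OF bilinear_op_lin(2)[OF bil] bilinear_op_lin(2)[OF bilinear_prod_op] eq[OF u] in_span])
  have "F u v = prod_op u v" for u v
    by (rule lin_eq_on_span[OF bilinear_op_lin(1)[OF bil] bilinear_op_lin(1)[OF bilinear_prod_op] eq2 in_span])
  thus "F = prod_op"
    by blast
qed

lemma lin_Pyr: "lin Pyr"
  unfolding Pyr_def M_eq_prod_op by (rule bilinear_op_lin(1)[OF bilinear_prod_op])

lemma Pyr_one: "Pyr 1 = xx + 2 * bb"
  by (simp add: Pyr_def M_eq_prod_op prod_op_def L_part_one R_part_one LR_part_one_one mult_2)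

lemma Pyr_xx: "Pyr (xx * u) = xx * Pyr u + bb * (xx * u) - xx * (bb * u)"
  by (simp add: Pyr_def M_eq_prod_op prod_op_def L_part_xx R_part_one LR_part_xx_left distrib_left)

lemma Pyr_bb: "Pyr (bb * u) = bb * Pyr u + xx * (bb * u) + bb * (bb * u)"
  by (simp add: Pyr_def M_eq_prod_op prod_op_def[of "bb * u"] L_part_bb R_part_one LR_part_bb_one)


section \<open>Eigenvectors from \<open>Pyr\<close> and \<open>L\<close>\<close>

lemmas U_linear = lin_add[OF lin_U] lin_diff[OF lin_U] lin_scale[OF lin_U]
lemmas V_linear = lin_add[OF lin_V] lin_diff[OF lin_V] lin_scale[OF lin_V]
lemmas Pyr_linear = lin_add[OF lin_Pyr] lin_diff[OF lin_Pyr] lin_scale[OF lin_Pyr]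

text \<open>
  The recursion for \<open>U\<close> involves \<open>V\<close>, so the commutation of \<open>U\<close> with \<open>Pyr\<close> has to be proved together
  with a formula for \<open>V(Pyr(u))\<close>. The correction terms in that formula are the ones that make it
  compatible with the recursions for \<open>xu\<close> and \<open>bu\<close>.
\<close>

lemma U_V_Pyr:
  "U (Pyr u) = Pyr (U u) + Pyr (U u) \<and>
   V (Pyr u) = Pyr (V u) + Pyr (V u) - (bb * V u + bb * V u) + bb * U u - xx * V u"
proof (induction u rule: xb_induct)
  case one
  have "U (bb :: 'a ab) = bb + bb + bb + bb + xx" "V (bb :: 'a ab) = bb + bb"
    "U (xx :: 'a ab) = xx + xx" "V (xx :: 'a ab) = xx"
    using U_bb[of 1] V_bb[of 1] U_xx[of 1] V_xx[of 1]
    by (simp_all add: U_one V_one mult_2 mult_2_right add_ac)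
  moreover have "Pyr (2 :: 'a ab) = xx + xx + bb + bb + bb + bb"
    using lin_add[OF lin_Pyr, of 1 1] by (simp add: Pyr_one mult_2 add_ac)
  ultimately show ?case
    by (simp add: Pyr_one U_one V_one U_linear V_linear mult_2 mult_2_right algebra_simps)
next
  case (add u v)
  thus ?case
    by (simp add: U_linear V_linear Pyr_linear distrib_left)
next
  case (scale c u)
  thus ?case
    by (simp add: U_linear V_linear Pyr_linear scale_mult_right ab.scale_right_distrib
        ab.scale_right_diff_distrib)
next
  case (xx u)
  thus ?case
    by (simp add: Pyr_xx U_xx V_xx U_bb V_bb U_linear V_linear Pyr_linear mult_2 distrib_left
        right_diff_distrib)
next
  case (bb u)
  thus ?case
    by (simp add: Pyr_xx Pyr_bb U_xx V_xx U_bb V_bb U_linear V_linear Pyr_linear mult_2 distrib_left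
        right_diff_distrib)
qed

lemma U_Pyr: "U (Pyr u) = scale 2 (Pyr (U u))"
  using U_V_Pyr[of u] by (simp add: scale_two mult_2)

lemma U_L: "U (L u) = L (U u)"
  by (simp add: L_def U_xx flip: xx_def)

lemma lin_L: "lin L"
  unfolding L_def by (rule lin_mult_left[OF lin_ident])

text \<open>
  Sequences of operations are encoded as words, with \<open>LA\<close> for \<open>L\<close> and \<open>LB\<close> for \<open>Pyr\<close>.
\<close>

fun eigvec :: "letter list \<Rightarrow> 'k::field ab" where
  "eigvec [] = 1"
| "eigvec (LA # ls) = L (eigvec ls)"
| "eigvec (LB # ls) = Pyr (eigvec ls)"

lemma pyr_L_orbit_eq: "pyr_L_orbit n = eigvec ` words n"
proof (induction n)
  case (Suc n)
  show ?case
    unfolding words_Suc pyr_L_orbit.simps Suc image_Un image_image eigvec.simps by (rule Un_commute)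
qed simp

lemma U_eigvec: "U (eigvec ls) = scale (2 ^ (count_list ls LB + 1)) (eigvec ls)"
proof (induction ls rule: eigvec.induct)
  case 1
  show ?case
    using scale_two[of 1] by (simp add: U_one)
next
  case (2 ls)
  thus ?case
    by (simp add: U_L lin_scale[OF lin_L])
next
  case (3 ls)
  thus ?case
    by (simp add: U_Pyr Pyr_linear)
qed


section \<open>The eigenvectors span\<close>

lemma Pyr_homog: "u \<in> homog n \<Longrightarrow> Pyr u \<in> homog (Suc n)"
proof (induction n arbitrary: u)
  case 0
  then obtain c where u: "u = scale c 1"
    using homog_0 by blast
  have "xx + (bb + bb) \<in> homog (Suc 0)"
    using xx_homog bb_homog by (auto intro!: ab.subspace_add[OF subspace_homog])
  thus ?case
    unfolding u Pyr_linear Pyr_one mult_2 by (rule ab.subspace_scale[OF subspace_homog])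
next
  case (Suc n)
  obtain v w where vw: "v \<in> homog n" "w \<in> homog n" "u = xx * v + bb * w"
    using homog_SucE[OF Suc.prems] .
  show ?case
    unfolding vw(3) Pyr_linear Pyr_xx Pyr_bb
    by (intro ab.subspace_add[OF subspace_homog] ab.subspace_diff[OF subspace_homog]
        xx_mult_homog bb_mult_homog Suc.IH vw(1,2))
qed

text \<open>
  Let \<open>E\<close> be the endomorphism of degree \<open>n\<close> with \<open>Pyr(u) \<equiv> b E(u)\<close> modulo left multiples of \<open>x\<close>; the
  claim is that \<open>E + j\<close> is onto. By the recursion for \<open>Pyr\<close>, on \<open>u = x u\<^sub>1 + b u\<^sub>2\<close> the operator \<open>E + j\<close>
  acts as \<open>1 + j\<close> on the part \<open>x u\<^sub>1\<close> and as \<open>E + (j + 1)\<close> on \<open>u\<^sub>2\<close>, up to a left multiple of \<open>x\<close>. This is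
  why \<open>j\<close> has to vary in the induction. In degree 0 the operator is \<open>2 + j\<close>, so that the scalars that
  have to be invertible lie between \<open>j + 1\<close> and \<open>j + n + 2\<close>.
\<close>

lemma Pyr_modulo_xx_surj:
  fixes v :: "'k::field ab"
  assumes "\<And>i. j < i \<Longrightarrow> i \<le> j + n + 2 \<Longrightarrow> of_nat i \<noteq> (0 :: 'k)" "v \<in> homog n"
  shows "\<exists>u \<in> homog n. \<exists>w \<in> homog n. Pyr u + scale (of_nat j) (bb * u) = bb * v + xx * w"
  using assms
proof (induction n arbitrary: j v)
  case 0
  obtain c where v: "v = scale c 1"
    using 0 homog_0 by blast
  define d where "d = c / of_nat (j + 2)"
  have d: "d * of_nat (j + 2) = c"
    using 0(1)[of "j + 2"] by (simp add: d_def)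
  have "scale c bb = scale d bb + scale d bb + scale (of_nat j * d) (bb :: 'k ab)"
  proof -
    have "c = d + d + of_nat j * d"
      using d by (simp add: algebra_simps)
    thus ?thesis
      by (simp only: ab.scale_left_distrib)
  qed
  hence "Pyr (scale d 1) + scale (of_nat j) (bb * scale d 1) = bb * v + xx * scale d 1"
    by (simp add: v Pyr_linear Pyr_one scale_mult_right mult_2 ab.scale_right_distrib add_ac)
  moreover have "scale d 1 \<in> homog 0"
    by (rule ab.subspace_scale[OF subspace_homog one_homog])
  ultimately show ?case
    by blast
next
  case (Suc n)
  obtain v1 v2 where v: "v1 \<in> homog n" "v2 \<in> homog n" "v = xx * v1 + bb * v2"
    using homog_SucE[OF Suc.prems(2)] .
  obtain u2 w2 where uw: "u2 \<in> homog n" "w2 \<in> homog n"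
    "Pyr u2 + scale (of_nat (Suc j)) (bb * u2) = bb * v2 + xx * w2"
    using Suc.IH[of "Suc j", OF Suc.prems(1) v(2)] by auto
  \<comment> \<open>The choice of \<open>u2\<close> leaves the remainder \<open>w2\<close>, which \<open>u1\<close> has to absorb.\<close>
  define u1 where "u1 = scale (inverse (of_nat (Suc j))) (v1 - w2)"
  have u1: "u1 \<in> homog n"
    unfolding u1_def using v uw
    by (intro ab.subspace_scale[OF subspace_homog] ab.subspace_diff[OF subspace_homog])
  have "scale (of_nat (Suc j)) u1 = v1 - w2"
    unfolding u1_def using Suc.prems(1)[of "Suc j"] by (simp add: del: of_nat_Suc)
  hence v1: "v1 = u1 + scale (of_nat j) u1 + w2"
    by (simp add: ab.scale_left_distrib)
  have v2: "bb * v2 = Pyr u2 + bb * u2 + scale (of_nat j) (bb * u2) - xx * w2"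
    using uw(3) by (simp add: ab.scale_left_distrib eq_diff_eq add_ac)
  define u where "u = xx * u1 + bb * u2"
  define w where "w = Pyr u1 - bb * u1 + bb * u2"
  have "u \<in> homog (Suc n)" "w \<in> homog (Suc n)"
    unfolding u_def w_def using u1 uw
    by (auto intro!: ab.subspace_add[OF subspace_homog] ab.subspace_diff[OF subspace_homog]
        xx_mult_homog bb_mult_homog Pyr_homog)
  moreover have "Pyr u + scale (of_nat j) (bb * u) = bb * v + xx * w"
    unfolding v(3) v2 v1
    by (simp add: u_def w_def Pyr_linear Pyr_xx Pyr_bb distrib_left right_diff_distrib
        ab.scale_right_distrib scale_mult_right)
  ultimately show ?case
    by blast
qed

lemma lin_image_span:
  assumes "lin f" "u \<in> ab.span G"
  shows "f u \<in> ab.span (f ` G)"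
  using assms(2)
proof (induction rule: ab.span_induct_alt)
  case (step c x y)
  thus ?case
    unfolding lin_add[OF assms(1)] lin_scale[OF assms(1)]
    by (blast intro: ab.span_add ab.span_scale ab.span_base)
qed (simp add: lin_zero[OF assms(1)] ab.span_zero)

text \<open>
  Modulo left multiples of \<open>x\<close>, which are values of \<open>L\<close>, every polynomial of degree \<open>n + 1\<close> is a value
  of \<open>Pyr\<close>.
\<close>

lemma homog_subset_span_orbit:
  assumes "\<And>i. 0 < i \<Longrightarrow> i \<le> n + 1 \<Longrightarrow> of_nat i \<noteq> (0 :: 'k::field)"
  shows "homog n \<subseteq> ab.span (pyr_L_orbit n :: 'k ab set)"
  using assms
proof (induction n)
  case 0
  show ?case
    using homog_0 by (auto simp: ab.span_singleton)
next
  case (Suc n)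
  have IH: "homog n \<subseteq> ab.span (pyr_L_orbit n :: 'k ab set)"
    using Suc by simp
  show ?case
  proof
    fix u :: "'k ab" assume "u \<in> homog (Suc n)"
    then obtain v1 v2 where v: "v1 \<in> homog n" "v2 \<in> homog n" "u = xx * v1 + bb * v2"
      by (rule homog_SucE)
    obtain u2 w where uw: "u2 \<in> homog n" "w \<in> homog n"
      "Pyr u2 + scale (of_nat 0) (bb * u2) = bb * v2 + xx * w"
      using Pyr_modulo_xx_surj[OF _ v(2), of 0] Suc.prems by auto
    have "u = Pyr u2 + L (v1 - w)"
      using uw(3) by (simp add: v(3) L_def right_diff_distrib flip: xx_def)
    moreover have "v1 - w \<in> homog n"
      using v(1) uw(2) by (rule ab.subspace_diff[OF subspace_homog])
    hence "L (v1 - w) \<in> ab.span (L ` pyr_L_orbit n)"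
      using IH by (intro lin_image_span lin_L) auto
    hence "L (v1 - w) \<in> ab.span (pyr_L_orbit (Suc n))"
      by (rule subsetD[OF ab.span_mono, rotated]) simp
    moreover have "Pyr u2 \<in> ab.span (Pyr ` pyr_L_orbit n)"
      using IH uw(1) by (intro lin_image_span lin_Pyr) auto
    hence "Pyr u2 \<in> ab.span (pyr_L_orbit (Suc n))"
      by (rule subsetD[OF ab.span_mono, rotated]) simp
    ultimately show "u \<in> ab.span (pyr_L_orbit (Suc n))"
      by (simp only: ab.span_add)
  qed
qed

lemma orbit_homog: "pyr_L_orbit n \<subseteq> homog n"
  by (induction n) (auto simp: one_homog L_def intro!: Pyr_homog xx_mult_homog simp flip: xx_def)

text \<open>
  A spanning set with at most as many elements as the dimension contains a basis, so it is one.
\<close>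

lemma orbit_basis:
  assumes "\<And>i. 0 < i \<Longrightarrow> i \<le> n + 1 \<Longrightarrow> of_nat i \<noteq> (0 :: 'k::field)"
  shows "ab.independent (pyr_L_orbit n :: 'k ab set)"
    and "ab.span (pyr_L_orbit n :: 'k ab set) = homog n"
    and "card (pyr_L_orbit n :: 'k ab set) = 2 ^ n"
proof -
  let ?B = "pyr_L_orbit n :: 'k ab set"
  have fin: "finite ?B" and card: "card ?B \<le> 2 ^ n"
    unfolding pyr_L_orbit_eq using finite_words[of n] card_image_le[OF finite_words[of n]]
    by (auto simp: card_words)
  show span: "ab.span ?B = homog n"
    using homog_subset_span_orbit[OF assms] ab.span_minimal[OF orbit_homog subspace_homog] by blast
  obtain B' where B': "B' \<subseteq> ?B" "ab.independent B'" "?B \<subseteq> ab.span B'"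
    by (rule ab.maximal_independent_subset)
  have "homog n \<subseteq> ab.span B'"
    using ab.span_minimal[OF B'(3) ab.subspace_span] span by simp
  hence "card B' = 2 ^ n"
    using ab.basis_card_eq_dim[of B' "homog n"] B' orbit_homog[of n] by (auto simp: dim_homog)
  hence "B' = ?B"
    using card_seteq[OF fin B'(1)] card by simp
  thus "ab.independent ?B" "card ?B = 2 ^ n"
    using B' \<open>card B' = 2 ^ n\<close> by auto
qed


section \<open>Dimensions of the eigenspaces\<close>

text \<open>
  Comparing coefficients in \<open>f v = c v\<close> shows that an eigenvector only involves those basis vectors
  that have the same eigenvalue.
\<close>

lemma dim_eigenspace:
  fixes e :: "'i \<Rightarrow> 'k::field ab"
  assumes f: "lin f" and I: "finite I" "inj_on e I" "ab.independent (e ` I)" "ab.span (e ` I) = W"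
    and eig: "\<And>i. i \<in> I \<Longrightarrow> f (e i) = scale (ev i) (e i)"
  shows "ab.dim (eigenspace f W c) = card {i \<in> I. ev i = c}"
proof -
  let ?J = "{i \<in> I. ev i = c}"
  have "eigenspace f W c \<subseteq> ab.span (e ` ?J)"
  proof
    fix v assume "v \<in> eigenspace f W c"
    hence v: "v \<in> ab.span (e ` I)" "f v = scale c v"
      using I(4) by (auto simp: eigenspace_def)
    from v(1) obtain r where "v = (\<Sum>b \<in> e ` I. scale (r b) b)"
      using I(1) by (auto simp: ab.span_finite)
    hence vr: "v = (\<Sum>i \<in> I. scale (r (e i)) (e i))"
      by (simp add: sum.reindex[OF I(2)])
    have "f v = (\<Sum>i \<in> I. scale (r (e i) * ev i) (e i))"
      unfolding vr lin_sum[OF f] by (rule sum.cong) (simp_all add: lin_scale[OF f] eig)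
    hence "(\<Sum>i \<in> I. scale (r (e i) * ev i) (e i)) = (\<Sum>i \<in> I. scale (r (e i) * c) (e i))"
      unfolding v(2) unfolding vr by (simp add: ab.scale_sum_right mult.commute)
    hence "(\<Sum>i \<in> I. scale (r (e i) * (ev i - c)) (e i)) = 0"
      by (simp add: right_diff_distrib ab.scale_left_diff_distrib sum_subtractf)
    \<comment> \<open>Linear independence is a statement about the set of the vectors \<open>e i\<close>, not about the family.\<close>
    hence "(\<Sum>b \<in> e ` I. scale (r b * (ev (the_inv_into I e b) - c)) b) = 0"
      by (simp add: sum.reindex[OF I(2)] the_inv_into_f_f[OF I(2)])
    hence "r (e i) * (ev i - c) = 0" if "i \<in> I" for i
      using ab.independentD[OF I(3), of "e ` I" _ "e i"] I(1) that
      by (fastforce simp: the_inv_into_f_f[OF I(2)])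
    hence "v = (\<Sum>i \<in> ?J. scale (r (e i)) (e i))"
      unfolding vr using I(1) by (intro sum.mono_neutral_right) auto
    also have "\<dots> \<in> ab.span (e ` ?J)"
      by (intro ab.span_sum ab.span_scale ab.span_base imageI)
    finally show "v \<in> ab.span (e ` ?J)" .
  qed
  moreover have "e ` ?J \<subseteq> eigenspace f W c"
    using I(4) eig by (auto simp: eigenspace_def intro: ab.span_base)
  moreover have "ab.independent (e ` ?J)"
    using I(3) by (rule ab.independent_mono) auto
  moreover have "card (e ` ?J) = card ?J"
    by (rule card_image) (rule inj_on_subset[OF I(2)], auto)
  ultimately show ?thesis
    by (intro ab.dim_unique)
qed

lemma card_words_count: "card {ls \<in> words n. count_list ls LB = i} = n choose i"
proof (induction n arbitrary: i)
  case 0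
  have "{ls \<in> words 0. count_list ls LB = i} = (if i = 0 then {[]} else {})"
    by auto
  thus ?case
    by simp
next
  case (Suc n)
  let ?W = "\<lambda>n i. {ls \<in> words n. count_list ls LB = i}"
  have fin: "finite (?W n i)" for i
    by (rule finite_subset[OF _ finite_words[of n]]) auto
  show ?case
  proof (cases i)
    case 0
    have "?W (Suc n) 0 = (#) LA ` ?W n 0"
      unfolding words_Suc by auto
    thus ?thesis
      using Suc[of 0] 0 by (simp add: card_image)
  next
    case (Suc j)
    have "?W (Suc n) (Suc j) = (#) LA ` ?W n (Suc j) \<union> (#) LB ` ?W n j"
      unfolding words_Suc by auto
    moreover have "card ((#) LA ` ?W n (Suc j) \<union> (#) LB ` ?W n j)
        = card ((#) LA ` ?W n (Suc j)) + card ((#) LB ` ?W n j)"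
      using fin by (intro card_Un_disjoint) auto
    ultimately show ?thesis
      using Suc.IH[of j] Suc.IH[of "Suc j"] Suc by (simp add: card_image)
  qed
qed

text \<open>
  The powers of 2 may coincide in \<open>'k\<close>, which is why the words are first sorted by the exponent.
\<close>

lemma card_words_eigenvalue:
  "card {ls \<in> words n. 2 ^ (count_list ls LB + 1) = c} = tcheb_mult n (c :: 'k::field)"
proof -
  let ?I = "{i. i \<le> n \<and> 2 ^ (i + 1) = c}"
  have "{ls \<in> words n. 2 ^ (count_list ls LB + 1) = c} = (\<Union>i \<in> ?I. {ls \<in> words n. count_list ls LB = i})"
    using count_le_length by auto
  also have "card \<dots> = (\<Sum>i \<in> ?I. card {ls \<in> words n. count_list ls LB = i})"
    by (rule card_UN_disjoint) (auto intro: finite_subset[OF _ finite_words[of n]])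
  finally show ?thesis
    by (simp only: card_words_count tcheb_mult_def)
qed

lemma power_two_inj:
  assumes "CHAR('k::field) = 0" "(2 :: 'k) ^ i = 2 ^ j"
  shows "i = j"
proof -
  have "i = j" if "i \<le> j" "(2 :: 'k) ^ i = 2 ^ j" for i j :: nat
  proof -
    have "of_nat (2 ^ j - 2 ^ i) = (0 :: 'k)"
      using that by (simp add: of_nat_diff)
    hence "(2::nat) ^ j - 2 ^ i = 0"
      using assms(1) by (simp only: of_nat_eq_0_iff_char_dvd dvd_0_left_iff)
    hence "(2::nat) ^ j \<le> 2 ^ i"
      by simp
    thus ?thesis
      using that(1) by simp
  qed
  thus ?thesis
    using assms(2) by (metis nle_le)
qed

lemma tcheb_mult_char_0:
  assumes "CHAR('k::field) = 0" "i \<le> n"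
  shows "tcheb_mult n ((2 :: 'k) ^ (i + 1)) = n choose i"
proof -
  have "{j. j \<le> n \<and> (2 :: 'k) ^ (j + 1) = 2 ^ (i + 1)} = {i}"
    using assms power_two_inj[OF assms(1), of "_ + 1" "i + 1"] by auto
  thus ?thesis
    by (simp add: tcheb_mult_def)
qed

section \<open>The eigenvalues and eigenvectors of the transform\<close>

theorem theorem10p10:
  fixes n :: nat
  assumes "CHAR('k::field) = 0 \<or> CHAR('k) > n + 1"
  shows "diagonalizable_on (U :: 'k ab \<Rightarrow> 'k ab) (homog n) \<and>
    (\<forall>c. ab.dim (eigenspace (U :: 'k ab \<Rightarrow> 'k ab) (homog n) c) = tcheb_mult n c) \<and>
    (CHAR('k) = 0 \<longrightarrow>
       (\<forall>i \<le> n. ab.dim (eigenspace (U :: 'k ab \<Rightarrow> 'k ab) (homog n) (2 ^ (i + 1))) = n choose i)) \<and>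
    eigenbasis (U :: 'k ab \<Rightarrow> 'k ab) (homog n) (pyr_L_orbit n) \<and>
    card (pyr_L_orbit n :: 'k ab set) = 2 ^ n"
proof -
  have nz: "of_nat i \<noteq> (0 :: 'k)" if "0 < i" "i \<le> n + 1" for i
    using assms that by (auto simp: of_nat_eq_0_iff_char_dvd dest: dvd_imp_le)
  note basis = orbit_basis[OF nz]
  let ?B = "pyr_L_orbit n :: 'k ab set"
  have eig: "\<exists>c. U v = scale c v" if "v \<in> ?B" for v
    using that U_eigvec by (auto simp: pyr_L_orbit_eq)
  have eb: "eigenbasis U (homog n) ?B"
    unfolding eigenbasis_def eigenvector_def
    using orbit_homog basis(1,2) eig ab.dependent_zero[of ?B] by auto
  have "U u \<in> homog n" if "u \<in> homog n" for u :: "'k ab"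
  proof -
    have "U u \<in> ab.span (U ` ?B)"
      using that basis(2) by (intro lin_image_span[OF lin_U]) auto
    also have "ab.span (U ` ?B) \<subseteq> ab.span ?B"
      by (rule ab.span_minimal) (use eig in \<open>fastforce intro: ab.span_scale ab.span_base\<close>)+
    finally show ?thesis
      by (simp add: basis(2))
  qed
  hence diag: "diagonalizable_on (U :: 'k ab \<Rightarrow> 'k ab) (homog n)"
    using eb unfolding diagonalizable_on_def by blast
  have inj: "inj_on (eigvec :: _ \<Rightarrow> 'k ab) (words n)"
    by (rule eq_card_imp_inj_on[OF finite_words])
      (use basis(3) in \<open>simp add: pyr_L_orbit_eq card_words\<close>)
  have dim: "ab.dim (eigenspace (U :: 'k ab \<Rightarrow> 'k ab) (homog n) c) = tcheb_mult n c" for c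
    using dim_eigenspace[OF lin_U finite_words inj basis(1,2)[unfolded pyr_L_orbit_eq] U_eigvec]
    by (simp only: card_words_eigenvalue)
  show ?thesis
    using diag dim eb basis(3) tcheb_mult_char_0 by auto
qed

end
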